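(* Let $K$ be a symmetric triangulation of $S^n$ aligned with hemispheres. Suppose $K$ has (i) an anti-symmetric labelling of its vertices by labels from $\{\pm 1, \pm 2, \ldots, \pm m\}$ and (ii) no complementary edge. Then there are an odd number of positive alternating $n$-simplices in $K$ and an equal number of negative alternating $n$-simplices in $K$. In particular, $m \geq n+1$. Moreover, there is a constructive procedure to locate an alternating $n$-simplex of each sign.
   Context: $S^n$ is identified with the unit sphere $\{x \in \mathbb{R}^{n+1} : \|x\| = 1\}$; for $A \subset S^n$, $-A$ denotes the antipodal set. A flag of hemispheres in $S^n$ is a sequence $H_0 \subset \dots \subset H_n$ of subsets of $S^n$ where each $H_d$ is homeomorphic to a $d$-ball, for $1 \leq d \leq n$ one has $\partial H_d = \partial(-H_d) = H_d \cap -H_d = H_{d-1} \cup -H_{d-1} \cong S^{d-1}$, also $H_n \cup -H_n = S^n$, and $\{H_0, -H_0\}$ are antipodal points. (Here $\partial H_d$ is the boundary sphere of the ball $H_d$.) A triangulation $K$ of $S^n$ is symmetric if $\sigma \in K$ implies $-\sigma \in K$ for every simplex $\sigma$. A symmetric triangulation is aligned with hemispheres if there is a flag of hemispheres $H_0 \subset \dots \subset H_n$ such that each $H_d$ is contained in the $d$-skeleton of the triangulation. A labelling assigns an integer to each vertex of the triangulation. It is anti-symmetric if the labels of each pair of antipodal vertices sum to zero. A complementary edge is an edge whose two endpoint labels sum to zero. A simplex of dimension $d$ in a labelled triangulation is alternating if its vertex labels are distinct in magnitude and alternate in sign when arranged in order of increasing absolute value, i.e. its labels have the form $\{k_0, -k_1,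 k_2, \ldots, (-1)^d k_d\}$ or $\{-k_0, k_1, -k_2, \ldots, (-1)^{d+1} k_d\}$ with $1 \le k_0 < k_1 < \dots < k_d \le m$. Its sign (positive or negative) is the sign of its label of smallest absolute value. *)

theory Defs
  imports "HOL-Analysis.Analysis"
begin

abbreviation antipode :: "'a::euclidean_space set \<Rightarrow> 'a set"
  where "antipode A \<equiv> uminus ` A"

section \<open>Triangulations as families of subsets of the triangulated space\<close>

text \<open>
  \<open>K\<close> triangulates \<open>X\<close> when its members are the images of the simplices of a geometric
  simplicial complex \<open>C\<close> under a homeomorphism \<open>h\<close> from the polyhedron of \<open>C\<close> onto \<open>X\<close>.
  As \<^const>\<open>simplicial_complex\<close> is closed under all faces, the empty simplex also belongs to \<open>K\<close>.
\<close>

definition triangulates ::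
  "'b::euclidean_space set set \<Rightarrow> ('b \<Rightarrow> 'a::euclidean_space) \<Rightarrow> 'a set \<Rightarrow> 'a set set \<Rightarrow> bool"
  where "triangulates C h X K \<longleftrightarrow>
    simplicial_complex C \<and> (\<exists>g. homeomorphism (\<Union>C) X h g) \<and> K = (\<lambda>S. h ` S) ` C"

definition vertices :: "'a set set \<Rightarrow> 'a set"
  where "vertices K = {v. {v} \<in> K}"

text \<open>The dimension of a simplex is one less than the number of its vertices.\<close>

definition simplices :: "'a set set \<Rightarrow> nat \<Rightarrow> 'a set set"
  where "simplices K d = {\<sigma> \<in> K. card (\<sigma> \<inter> vertices K) = d + 1}"

definition skeleton :: "'a set set \<Rightarrow> nat \<Rightarrow> 'a set"
  where "skeleton K d = (\<Union>e\<le>d. \<Union>(simplices K e))"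

definition symmetric_triangulation :: "'a::euclidean_space set set \<Rightarrow> bool"
  where "symmetric_triangulation K \<longleftrightarrow> (\<forall>\<sigma>\<in>K. antipode \<sigma> \<in> K)"

section \<open>Flags of hemispheres\<close>

text \<open>
  The unit ball of dimension \<open>d\<close> lives in \<^const>\<open>Euclidean_space\<close>, because \<open>d\<close> varies within a flag.
\<close>

definition unit_ball :: "nat \<Rightarrow> (nat \<Rightarrow> real) topology"
  where "unit_ball d = subtopology (Euclidean_space d) {x. (\<Sum>i<d. x i ^ 2) \<le> 1}"

text \<open>
  \<open>A\<close> is homeomorphic to a \<open>d\<close>-ball and \<open>B\<close> is its boundary sphere, that is, the image of the unit
  sphere. By invariance of domain \<open>B\<close> does not depend on the homeomorphism.
\<close>

definition ball_with_boundary ::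
  "nat \<Rightarrow> 'a::topological_space set \<Rightarrow> 'a set \<Rightarrow> bool"
  where "ball_with_boundary d A B \<longleftrightarrow>
    (\<exists>f. homeomorphic_map (unit_ball d) (top_of_set A) f \<and>
         f ` {x \<in> topspace (unit_ball d). (\<Sum>i<d. x i ^ 2) = 1} = B)"

text \<open>A \<open>0\<close>-ball is a point, so the first condition on \<open>H 0\<close> covers \<open>d = 0\<close>.\<close>

definition flag_of_hemispheres :: "nat \<Rightarrow> (nat \<Rightarrow> 'a::euclidean_space set) \<Rightarrow> bool"
  where "flag_of_hemispheres n H \<longleftrightarrow>
    (\<forall>d\<le>n. H d \<subseteq> sphere 0 1) \<and>
    (\<forall>d<n. H d \<subseteq> H (Suc d)) \<and>
    (\<exists>x. H 0 = {x}) \<and>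
    (\<forall>d. 1 \<le> d \<and> d \<le> n \<longrightarrow>
       ball_with_boundary d (H d) (H d \<inter> antipode (H d)) \<and>
       ball_with_boundary d (antipode (H d)) (H d \<inter> antipode (H d)) \<and>
       H d \<inter> antipode (H d) = H (d - 1) \<union> antipode (H (d - 1)) \<and>
       top_of_set (H (d - 1) \<union> antipode (H (d - 1))) homeomorphic_space nsphere (d - 1)) \<and>
    H n \<union> antipode (H n) = sphere 0 1"

definition aligned_with :: "'a::euclidean_space set set \<Rightarrow> nat \<Rightarrow> (nat \<Rightarrow> 'a set) \<Rightarrow> bool"
  where "aligned_with K n H \<longleftrightarrow>
    flag_of_hemispheres n H \<and> (\<forall>d\<le>n. H d \<subseteq> skeleton K d)"

section \<open>Labellings\<close>

definition labels_in :: "'a set set \<Rightarrow> ('a \<Rightarrow> int) \<Rightarrow> nat \<Rightarrow> bool"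
  where "labels_in K l m \<longleftrightarrow> (\<forall>v\<in>vertices K. 1 \<le> \<bar>l v\<bar> \<and> \<bar>l v\<bar> \<le> int m)"

definition antisymmetric_labelling :: "'a::euclidean_space set set \<Rightarrow> ('a \<Rightarrow> int) \<Rightarrow> bool"
  where "antisymmetric_labelling K l \<longleftrightarrow> (\<forall>v\<in>vertices K. l v + l (- v) = 0)"

definition complementary_edge :: "'a set set \<Rightarrow> ('a \<Rightarrow> int) \<Rightarrow> 'a set \<Rightarrow> bool"
  where "complementary_edge K l \<sigma> \<longleftrightarrow>
    \<sigma> \<in> simplices K 1 \<and> (\<exists>u v. \<sigma> \<inter> vertices K = {u, v} \<and> l u + l v = 0)"

text \<open>
  The sign \<open>s\<close> of an alternating simplex is \<open>1\<close> or \<open>- 1\<close>. A \<open>d\<close>-simplex has \<open>d + 1\<close> vertices,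
  so equality of the label sets makes the labels distinct.
\<close>

definition alternating :: "'a set set \<Rightarrow> ('a \<Rightarrow> int) \<Rightarrow> int \<Rightarrow> nat \<Rightarrow> 'a set \<Rightarrow> bool"
  where "alternating K l s d \<sigma> \<longleftrightarrow>
    \<sigma> \<in> simplices K d \<and> s \<in> {1, - 1} \<and>
    (\<exists>k :: nat \<Rightarrow> int. 1 \<le> k 0 \<and> (\<forall>i<d. k i < k (Suc i)) \<and>
       l ` (\<sigma> \<inter> vertices K) = (\<lambda>i. s * (- 1) ^ i * k i) ` {..d})"

section \<open>The path-following procedure\<close>

definition hemisphere :: "(nat \<Rightarrow> 'a::euclidean_space set) \<Rightarrow> int \<Rightarrow> nat \<Rightarrow> 'a set"
  where "hemisphere H s d = (if s = 1 then H d else antipode (H d))"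

text \<open>The carrier of a simplex is the smallest hemisphere of the flag or its antipode containing it.\<close>

definition carried_by ::
  "(nat \<Rightarrow> 'a::euclidean_space set) \<Rightarrow> int \<Rightarrow> nat \<Rightarrow> 'a set \<Rightarrow> bool"
  where "carried_by H s d \<sigma> \<longleftrightarrow>
    s \<in> {1, - 1} \<and> \<sigma> \<subseteq> hemisphere H s d \<and>
    (\<forall>e<d. \<not> \<sigma> \<subseteq> H e \<and> \<not> \<sigma> \<subseteq> antipode (H e))"

text \<open>
  One may pass between an alternating \<open>e\<close>-simplex \<open>\<rho>\<close> and an \<open>(e + 1)\<close>-simplex \<open>\<tau>\<close> having \<open>\<rho>\<close> as a
  facet, provided that the carrier of \<open>\<tau>\<close> is the \<open>(e + 1)\<close>-dimensional hemisphere whose sign is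
  that of \<open>\<rho>\<close>.
\<close>

definition doorway ::
  "'a::euclidean_space set set \<Rightarrow> (nat \<Rightarrow> 'a set) \<Rightarrow> ('a \<Rightarrow> int) \<Rightarrow> 'a set \<Rightarrow> 'a set \<Rightarrow> bool"
  where "doorway K H l \<rho> \<tau> \<longleftrightarrow>
    (\<exists>s e. alternating K l s e \<rho> \<and> \<tau> \<in> simplices K (Suc e) \<and> \<rho> \<subseteq> \<tau> \<and>
       carried_by H s (Suc e) \<tau>)"

definition path_adjacent ::
  "'a::euclidean_space set set \<Rightarrow> (nat \<Rightarrow> 'a set) \<Rightarrow> ('a \<Rightarrow> int) \<Rightarrow> 'a set \<Rightarrow> 'a set \<Rightarrow> bool"
  where "path_adjacent K H l \<sigma> \<tau> \<longleftrightarrow> doorway K H l \<sigma> \<tau> \<or> doorway K H l \<tau> \<sigma>"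

text \<open>
  A complete run of the deterministic procedure: start at the point \<open>H 0\<close>; as long as the current
  simplex is not an alternating \<open>n\<close>-simplex, move to its only unvisited neighbour; stop at the first
  alternating \<open>n\<close>-simplex, which is the last entry of the list.
\<close>

definition path_following_run ::
  "'a::euclidean_space set set \<Rightarrow> (nat \<Rightarrow> 'a set) \<Rightarrow> ('a \<Rightarrow> int) \<Rightarrow> nat \<Rightarrow> 'a set list \<Rightarrow> bool"
  where "path_following_run K H l n ps \<longleftrightarrow>
    ps \<noteq> [] \<and> ps ! 0 = H 0 \<and>
    (\<forall>i. Suc i < length ps \<longrightarrow>
       (\<forall>s. \<not> alternating K l s n (ps ! i)) \<and>
       {\<tau>. path_adjacent K H l (ps ! i) \<tau>} - set (take i ps) = {ps ! Suc i}) \<and>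
    (\<exists>s. alternating K l s n (last ps))"

end

theory Submission
  imports Defs
begin

text \<open>
  The argument is combinatorial once each hemisphere \<open>H d\<close> and its antipode are known to be
  subcomplexes in which facets behave as in a manifold with boundary: a \<open>(d - 1)\<close>-simplex of the
  hemisphere is a facet of exactly one of its \<open>d\<close>-simplices if it lies on the boundary
  \<open>H (d - 1) \<union> - H (d - 1)\<close>, and of exactly two if it does not (\<open>card_facet_cofaces\<close>). The hemispheres
  are only topological balls, so this is a theorem of topology; it follows from invariance of domain
  alone. A \<open>d\<close>-ball inside the \<open>d\<close>-skeleton whose boundary lies in the \<open>(d - 1)\<close>-skeleton is a union of
  \<open>d\<close>-simplices: its trace on the relative interior of a \<open>d\<close>-simplex is both open and closed
  (\<open>eq_Union_tops\<close>). Two of its \<open>d\<close>-simplices that share a facet form, near an interior point of that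
  facet, an open piece of \<open>d\<close>-space, and such a piece is open in the ball and misses its boundary. Hence
  there is no third one, and no second one at a boundary point; a single one at a point off the boundary
  is impossible, because the ball is locally \<open>d\<close>-space there (\<open>card_tops_containing\<close>).

  The second ingredient concerns the labels of one simplex without complementary edges. For a fixed
  sign, an alternating simplex has exactly one alternating facet of that sign, obtained by deleting its
  largest or its smallest label, and any other simplex has none or two: in the order of absolute values a
  non-alternating simplex with such a facet has exactly one pair of consecutive labels of equal sign,
  and either of the two can be deleted (\<open>card_alternating_facets\<close>).

  Counting incidences between positive alternating \<open>d\<close>-simplices and the \<open>(d + 1)\<close>-simplices of
  \<open>H (d + 1)\<close> in two ways gives modulo 2 the number of alternating \<open>(d + 1)\<close>-simplices of \<open>H (d + 1)\<close> on
  one side, and on the other the number of positive alternating \<open>d\<close>-simplices of \<open>H d \<union> - H d\<close>. By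
  antisymmetry the latter is the number of alternating \<open>d\<close>-simplices of either sign in \<open>H d\<close>. So the number
  of alternating simplices of full dimension in \<open>H d\<close> has the same parity for all \<open>d\<close>, namely that of the
  single point \<open>H 0\<close>, and for \<open>d = n\<close> it is the number of positive alternating \<open>n\<close>-simplices of the sphere.
  The antipodal map exchanges positive and negative ones, and the \<open>n + 1\<close> distinct absolute values in
  one of them give \<open>m \<ge> n + 1\<close>.

  The same two facts show that in the graph of doorways every vertex with a neighbour has exactly two, except
  for \<open>H 0\<close>, its antipode and the alternating \<open>n\<close>-simplices (\<open>two_neighbours\<close>). The path that starts at
  \<open>H 0\<close> therefore continues without choice until it reaches an alternating \<open>n\<close>-simplex or \<open>- H 0\<close>. The second is
  impossible: the antipodal map would reverse the path and fix its midpoint (\<open>path_to_goal\<close>).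
\<close>

section \<open>Balls embedded in Euclidean space\<close>

lemma unit_ball_eq_top_of_set:
  "unit_ball d = top_of_set {x. (\<forall>i\<ge>d. x i = 0) \<and> (\<Sum>i<d. x i ^ 2) \<le> 1}"
  unfolding unit_ball_def Euclidean_space_def euclidean_product_topology subtopology_subtopology
  by (rule arg_cong[where f = top_of_set]) auto

lemma homeomorphic_map_top_of_set_iff:
  "homeomorphic_map (top_of_set S) (top_of_set T) f \<longleftrightarrow> (\<exists>g. homeomorphism S T f g)"
proof -
  have "homeomorphic_maps (top_of_set S) (top_of_set T) f g \<longleftrightarrow> homeomorphism S T f g" for g
    unfolding homeomorphic_maps_def homeomorphism_def
    by (simp add: Pi_iff) (safe; (blast | force)?)
  then show ?thesis by (simp add: homeomorphic_map_maps)
qed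

text \<open>
  The model ball is replaced by the unit ball of a linear subspace \<open>V\<close> of a fixed Euclidean space. Invariance
  of domain applies to open subsets of such subspaces, and all dimensions \<open>d\<close> of a flag fit into one type.
\<close>

lemma ball_with_boundary_chart:
  fixes A B :: "'x::topological_space set"
  assumes "ball_with_boundary d A B" and "d \<le> DIM('c::euclidean_space)"
  obtains V :: "'c::euclidean_space set" and F G where "subspace V" "dim V = d"
    "homeomorphism (cball 0 1 \<inter> V) A F G" "F ` (sphere 0 1 \<inter> V) = B"
proof -
  define D where "D = {x :: nat \<Rightarrow> real. (\<forall>i\<ge>d. x i = 0) \<and> (\<Sum>i<d. x i ^ 2) \<le> 1}"
  obtain f g where fg: "homeomorphism D A f g"
    and fB: "f ` {x \<in> D. (\<Sum>i<d. x i ^ 2) = 1} = B"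
    using assms(1) unfolding ball_with_boundary_def unit_ball_eq_top_of_set
      homeomorphic_map_top_of_set_iff D_def by auto
  obtain S where S: "S \<subseteq> (Basis :: 'c set)" "card S = d"
    using assms(2) obtain_subset_with_card_n by metis
  then obtain b where b: "bij_betw b {..<d} S"
    using finite_subset[OF S(1) finite_Basis] ex_bij_betw_nat_finite[of S]
    by (auto simp: atLeast0LessThan)
  define V where "V = {x :: 'c. \<forall>i\<in>Basis. i \<notin> S \<longrightarrow> x \<bullet> i = 0}"
  define p where "p = (\<lambda>v i. if i < d then v \<bullet> b i else 0)"
  define q where "q = (\<lambda>x :: nat \<Rightarrow> real. \<Sum>i<d. x i *\<^sub>R b i)"
  have bB: "b i \<in> Basis" "b i \<in> S" if "i < d" for i
    using b S that by (auto simp: bij_betw_def)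
  have bb: "b i \<bullet> b j = (if i = j then 1 else 0)" if "i < d" "j < d" for i j
    using bB b that by (auto simp: inner_Basis bij_betw_def inj_on_def)
  have qb: "q x \<bullet> b j = x j" if "j < d" for x j
    using that by (simp add: q_def inner_sum_left bb if_distrib cong: if_cong)
  have qV: "q x \<in> V" for x
    unfolding V_def q_def using bB b
    by (auto simp: inner_sum_left inner_Basis intro!: sum.neutral)
  have qp: "q (p v) = v" if "v \<in> V" for v
  proof -
    have "q (p v) = (\<Sum>i<d. (v \<bullet> b i) *\<^sub>R b i)"
      by (simp add: q_def p_def)
    also have "\<dots> = (\<Sum>s\<in>S. (v \<bullet> s) *\<^sub>R s)"
      using sum.reindex_bij_betw[OF b, of "\<lambda>s. (v \<bullet> s) *\<^sub>R s"] by simp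
    also have "\<dots> = (\<Sum>s\<in>Basis. (v \<bullet> s) *\<^sub>R s)"
      using that S by (intro sum.mono_neutral_left) (auto simp: V_def)
    finally show ?thesis by (simp add: euclidean_representation)
  qed
  have nq: "norm (q x) ^ 2 = (\<Sum>i<d. x i ^ 2)" for x
  proof -
    have "norm (q x) ^ 2 = q x \<bullet> (\<Sum>i<d. x i *\<^sub>R b i)"
      by (simp add: q_def dot_square_norm)
    also have "\<dots> = (\<Sum>i<d. x i ^ 2)"
      by (simp add: inner_sum_right qb power2_eq_square)
    finally show ?thesis .
  qed
  have pq: "p (q x) = x" if "\<forall>i\<ge>d. x i = 0" for x
    using that qb by (auto simp: p_def fun_eq_iff)
  have nle: "norm (q x) \<le> 1 \<longleftrightarrow> (\<Sum>i<d. x i ^ 2) \<le> 1" for x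
    using nq[of x] abs_le_square_iff[of "norm (q x)" 1] by auto
  have neq: "norm (q x) = 1 \<longleftrightarrow> (\<Sum>i<d. x i ^ 2) = 1" for x
    using nq[of x] by (metis norm_ge_zero one_power2 power2_eq_iff_nonneg zero_le_one)
  have p0: "p v i = 0" if "i \<ge> d" for v i
    using that by (simp add: p_def)
  have qD: "q ` D = cball 0 1 \<inter> V"
  proof (intro set_eqI iffI)
    fix v assume "v \<in> cball 0 1 \<inter> V"
    then have "v = q (p v)" "p v \<in> D"
      using qp[of v] nle[of "p v"] p0 by (auto simp: D_def)
    then show "v \<in> q ` D" by blast
  qed (use qV nle in \<open>auto simp: D_def\<close>)
  have qs: "p ` (sphere 0 1 \<inter> V) = {x \<in> D. (\<Sum>i<d. x i ^ 2) = 1}" (is "_ = ?R")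
  proof (intro set_eqI iffI)
    fix x assume "x \<in> ?R"
    then have "x = p (q x)" "q x \<in> sphere 0 1 \<inter> V"
      using pq[of x] neq[of x] qV by (auto simp: D_def)
    then show "x \<in> p ` (sphere 0 1 \<inter> V)" by blast
  next
    fix x assume "x \<in> p ` (sphere 0 1 \<inter> V)"
    then obtain v where "v \<in> V" "norm v = 1" "x = p v" by auto
    then show "x \<in> ?R"
      using qp[of v] neq[of "p v"] p0 by (auto simp: D_def)
  qed
  have cp: "continuous_on UNIV p"
  proof (rule continuous_on_coordinatewise_then_product)
    fix i show "continuous_on UNIV (\<lambda>v. p v i)"
      unfolding p_def by (cases "i < d") (auto intro!: continuous_intros)
  qed
  have cq: "continuous_on UNIV q"
    unfolding q_def by (intro continuous_intros) auto
  have "homeomorphism (cball 0 1 \<inter> V) D p q"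
    unfolding homeomorphism_def qD[symmetric]
    using cp cq pq
    by (auto intro: continuous_on_subset simp: D_def image_iff)
  from homeomorphism_compose[OF this fg]
  have "homeomorphism (cball 0 1 \<inter> V) A (f \<circ> p) (q \<circ> g)" .
  moreover have "(f \<circ> p) ` (sphere 0 1 \<inter> V) = B"
    by (simp only: image_comp[symmetric] qs fB)
  moreover have "subspace V"
    unfolding V_def by (auto simp: subspace_def inner_add_left)
  moreover have "dim V = d"
    using dim_substandard[OF S(1)] S(2) by (simp add: V_def)
  ultimately show ?thesis by (rule that[rotated 2])
qed

section \<open>Relative interiors in simplicial complexes\<close>

lemma simplicial_complexD:
  assumes "simplicial_complex C"
  shows "finite C" "S \<in> C \<Longrightarrow> \<exists>n. n simplex S" "S \<in> C \<Longrightarrow> F face_of S \<Longrightarrow> F \<in> C"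
    "S \<in> C \<Longrightarrow> T \<in> C \<Longrightarrow> (S \<inter> T) face_of S"
    "S \<in> C \<Longrightarrow> convex S" "S \<in> C \<Longrightarrow> compact S" "S \<in> C \<Longrightarrow> closed S" "S \<in> C \<Longrightarrow> polyhedron S"
  using assms unfolding simplicial_complex_def
  by (auto intro: convex_simplex compact_simplex closed_simplex simplex_imp_polyhedron)

text \<open>
  A point in the relative interior of a simplex detects all simplices of the complex that contain it:
  this is how inclusions between simplices are derived from facts about single points.
\<close>

lemma complex_subset_if_rel_interior_point:
  assumes "simplicial_complex C" "S \<in> C" "T \<in> C" "x \<in> rel_interior S" "x \<in> T"
  shows "S \<subseteq> T"
proof -
  have "x \<in> S" using assms(4) rel_interior_subset by blast
  then have "S \<subseteq> S \<inter> T"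
    using subset_of_face_of[OF simplicial_complexD(4)[OF assms(1-3)] order_refl] assms(4,5)
    by blast
  then show ?thesis by blast
qed

lemma complex_eq_if_aff_dim_le:
  assumes "simplicial_complex C" "S \<in> C" "T \<in> C" "S \<subseteq> T" "aff_dim T \<le> aff_dim S"
  shows "S = T"
proof (rule ccontr)
  assume "S \<noteq> T"
  moreover have "S face_of T"
    using simplicial_complexD(4)[OF assms(1,3,2)] assms(4) by (simp add: Int_absorb1)
  ultimately show False
    using face_of_aff_dim_lt[of T S] simplicial_complexD(5)[OF assms(1,3)] assms(5) by auto
qed

text \<open>
  A simplex of least dimension among those containing the point works, because a point of the relative
  frontier would lie in a proper face.
\<close>

lemma complex_rel_interior_point:
  assumes "simplicial_complex C" "S \<in> C" "x \<in> S"
  obtains T where "T \<in> C" "x \<in> rel_interior T" "T \<subseteq> S"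
proof -
  define D where "D = {T \<in> C. x \<in> T}"
  have "finite D" "D \<noteq> {}"
    using simplicial_complexD(1)[OF assms(1)] assms(2,3) by (auto simp: D_def)
  then obtain T where T: "T \<in> D" "\<And>U. U \<in> D \<Longrightarrow> aff_dim T \<le> aff_dim U"
    using ex_min_if_finite[of "aff_dim ` D"] by (metis (no_types, lifting) finite_imageI image_iff image_is_empty linorder_not_less)
  have TC: "T \<in> C" "x \<in> T" using T(1) by (auto simp: D_def)
  have xT: "x \<in> rel_interior T"
  proof (rule ccontr)
    assume "x \<notin> rel_interior T"
    then have "x \<in> rel_frontier T"
      using TC closure_subset by (auto simp: rel_frontier_def)
    then obtain F where "F face_of T" "F \<noteq> T" "x \<in> F"
      using rel_frontier_of_polyhedron_alt[OF simplicial_complexD(8)[OF assms(1) TC(1)]] by auto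
    moreover from this have "aff_dim F < aff_dim T"
      using face_of_aff_dim_lt simplicial_complexD(5)[OF assms(1) TC(1)] by blast
    ultimately show False
      using T(2)[of F] simplicial_complexD(3)[OF assms(1) TC(1)] by (auto simp: D_def)
  qed
  show ?thesis
    using that[OF TC(1) xT] complex_subset_if_rel_interior_point[OF assms(1) TC(1) assms(2) xT assms(3)] .
qed

text \<open>
  What the skeleton contains besides the relative interior of \<open>S\<close> is the frontier of \<open>S\<close> and finitely many
  simplices that miss the relative interior, hence a closed set.
\<close>

lemma rel_interior_openin_skeleton:
  assumes "simplicial_complex C" "S \<in> C" "X \<subseteq> \<Union>{T\<in>C. aff_dim T \<le> aff_dim S}"
  shows "openin (top_of_set X) (rel_interior S \<inter> X)"
proof -
  define R where "R = \<Union>{T\<in>C. aff_dim T \<le> aff_dim S \<and> T \<noteq> S}"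
  have "closed R"
    unfolding R_def using simplicial_complexD(1,7)[OF assms(1)] by (intro closed_Union) auto
  have "compact S" using simplicial_complexD(6)[OF assms(1,2)] .
  have disj: "rel_interior S \<inter> R = {}"
    unfolding R_def
    using complex_subset_if_rel_interior_point[OF assms(1,2)]
      complex_eq_if_aff_dim_le[OF assms(1,2)] by blast
  have rc: "closed (rel_frontier S)"
    using \<open>compact S\<close> compact_imp_closed compact_rel_frontier_bounded compact_imp_bounded by blast
  have "X \<subseteq> S \<union> R" using assms(3) unfolding R_def by blast
  moreover have "rel_frontier S = S - rel_interior S"
    using \<open>compact S\<close> by (simp add: rel_frontier_def compact_imp_closed closure_closed)
  ultimately have "rel_interior S \<inter> X = X \<inter> - (R \<union> rel_frontier S)"
    using disj by blast
  moreover have "open (- (R \<union> rel_frontier S))"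
    using \<open>closed R\<close> rc by (intro open_Compl closed_Un)
  ultimately show ?thesis by (metis openin_open_Int)
qed

text \<open>
  Pulled back to the ball, the image is open in \<open>V\<close> by invariance of domain. An open subset of \<open>V\<close> inside the
  closed unit ball contains no point of norm 1, as it could be moved outwards along its ray.
\<close>

lemma closed_ball_embedding_open_image:
  fixes V :: "'c::euclidean_space set" and X :: "'b::euclidean_space set" and W :: "'e::euclidean_space set"
  assumes V: "subspace V" and F: "homeomorphism (cball 0 1 \<inter> V) X F G"
    and W: "affine W" "aff_dim W = dim V" and U: "openin (top_of_set W) U"
    and \<phi>: "continuous_on U \<phi>" "inj_on \<phi> U" "\<phi> ` U \<subseteq> X"
  shows "openin (top_of_set X) (\<phi> ` U)" "\<phi> ` U \<inter> F ` (sphere 0 1 \<inter> V) = {}"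
proof -
  define P where "P = (G \<circ> \<phi>) ` U"
  have GX: "G ` X = cball 0 1 \<inter> V" and FG: "\<And>y. y \<in> X \<Longrightarrow> F (G y) = y"
    and GF: "\<And>v. v \<in> cball 0 1 \<inter> V \<Longrightarrow> G (F v) = v"
    using F by (auto simp: homeomorphism_def)
  have "inj_on G X" using FG by (metis inj_onI)
  have "openin (top_of_set V) P"
    unfolding P_def
  proof (rule invariance_of_domain_affine_sets[OF U W(1)])
    show "affine V" using V by (rule subspace_imp_affine)
    show "aff_dim V \<le> aff_dim W" using W V by (simp add: aff_dim_subspace)
    show "continuous_on U (G \<circ> \<phi>)"
      using \<phi> F by (meson continuous_on_compose continuous_on_subset homeomorphism_def)
    show "G \<circ> \<phi> \<in> U \<rightarrow> V"
      using \<phi>(3) GX unfolding Pi_iff comp_apply by blast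
    show "inj_on (G \<circ> \<phi>) U"
      using \<phi>(2,3) \<open>inj_on G X\<close> by (meson comp_inj_on inj_on_subset)
  qed
  have PV: "P \<subseteq> cball 0 1 \<inter> V" using \<phi>(3) GX by (auto simp: P_def)
  have FP: "F ` P = \<phi> ` U" using FG \<phi>(3) by (force simp: P_def image_image)
  have "openin (top_of_set (cball 0 1 \<inter> V)) P"
    using \<open>openin (top_of_set V) P\<close> PV by (meson Int_lower2 openin_subset_trans)
  then show "openin (top_of_set X) (\<phi> ` U)"
    using homeomorphism_imp_open_map[OF F] FP by metis
  have "norm p < 1" if "p \<in> P" for p
  proof (rule ccontr)
    assume "\<not> norm p < 1"
    then have "norm p = 1" using PV that by auto
    obtain e where "e > 0" and e: "ball p e \<inter> V \<subseteq> P"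
      using \<open>openin (top_of_set V) P\<close> \<open>p \<in> P\<close> openin_contains_ball by metis
    have "(1 + e/2) *\<^sub>R p \<in> ball p e"
      using \<open>norm p = 1\<close> \<open>e > 0\<close> by (simp add: dist_norm algebra_simps)
    moreover have "(1 + e/2) *\<^sub>R p \<in> V"
      using PV that V by (auto intro: subspace_scale)
    ultimately have "(1 + e/2) *\<^sub>R p \<in> cball 0 1" using e PV by blast
    then show False using \<open>norm p = 1\<close> \<open>e > 0\<close> by simp
  qed
  then have "P \<inter> sphere 0 1 = {}" by force
  moreover have "inj_on F (cball 0 1 \<inter> V)" using GF by (metis inj_onI)
  ultimately have "F ` P \<inter> F ` (sphere 0 1 \<inter> V) = {}"
    using PV by (subst inj_on_image_Int[of F "cball 0 1 \<inter> V", symmetric]) auto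
  then show "\<phi> ` U \<inter> F ` (sphere 0 1 \<inter> V) = {}" by (simp add: FP)
qed

text \<open>
  Off the boundary sphere the chart is defined on an open subset of \<open>V\<close>, so invariance of domain and of
  dimension apply to the chart itself.
\<close>

lemma closed_ball_embedding_open_subset:
  fixes V :: "'c::euclidean_space set" and X :: "'b::euclidean_space set"
  assumes V: "subspace V" and F: "homeomorphism (cball 0 1 \<inter> V) X F G"
    and W: "affine W" and N: "openin (top_of_set X) N" "N \<inter> F ` (sphere 0 1 \<inter> V) = {}" "N \<subseteq> W"
  shows "N \<noteq> {} \<Longrightarrow> dim V \<le> aff_dim W" "aff_dim W \<le> dim V \<Longrightarrow> openin (top_of_set W) N"
proof -
  have NX: "N \<subseteq> X" using N(1) openin_imp_subset by blast
  have GX: "G ` X = cball 0 1 \<inter> V" and FG: "\<And>y. y \<in> X \<Longrightarrow> F (G y) = y"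
    using F by (auto simp: homeomorphism_def)
  have "openin (top_of_set (cball 0 1 \<inter> V)) (G ` N)"
    using homeomorphism_imp_open_map[OF homeomorphism_symD[OF F] N(1)] .
  moreover have sub: "G ` N \<subseteq> ball 0 1 \<inter> V"
  proof
    fix v assume "v \<in> G ` N"
    then obtain y where y: "y \<in> N" "v = G y" by blast
    then have "v \<in> cball 0 1 \<inter> V" "F v = y" using NX FG GX by blast+
    then show "v \<in> ball 0 1 \<inter> V" using N(2) y(1) by force
  qed
  ultimately have "openin (top_of_set (ball 0 1 \<inter> V)) (G ` N)"
    by (meson Int_mono ball_subset_cball openin_subset_trans order_refl)
  then have op: "openin (top_of_set V) (G ` N)"
    by (metis inf_commute open_ball openin_open_Int openin_trans)
  have FGN: "F ` G ` N = N" using FG NX by (force simp: image_image)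
  have cF: "continuous_on (G ` N) F"
    using F sub by (meson Int_mono ball_subset_cball continuous_on_subset homeomorphism_def order_refl)
  have iF: "inj_on F (G ` N)" using FG NX by (auto simp: inj_on_def subset_iff)
  have FW: "F \<in> G ` N \<rightarrow> W" using FGN N(3) by blast
  have aV: "affine V" "aff_dim V = dim V"
    using V by (simp_all add: subspace_imp_affine aff_dim_subspace)
  show "N \<noteq> {} \<Longrightarrow> dim V \<le> aff_dim W"
    using invariance_of_dimension_affine_sets[OF op aV(1) W cF FW iF] aV(2) by simp
  show "aff_dim W \<le> dim V \<Longrightarrow> openin (top_of_set W) N"
    using invariance_of_domain_affine_sets[OF op aV(1) W _ cF FW iF] aV(2) FGN by simp
qed

section \<open>Two simplices sharing a facet\<close>

text \<open>
  The coordinates are affine functions on the whole space. This makes their continuity evident and lets them be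
  evaluated on the faces of the simplex spanned by \<open>S\<close>.
\<close>

lemma barycentric_coordinates:
  fixes S :: "'b::euclidean_space set"
  assumes "\<not> affine_dependent S"
  shows "\<exists>c :: 'b \<Rightarrow> 'b \<Rightarrow> real. (\<forall>s. continuous_on UNIV (c s)) \<and>
    (\<forall>T u. T \<subseteq> S \<longrightarrow> sum u T = 1 \<longrightarrow>
      (\<forall>s\<in>S. c s (\<Sum>t\<in>T. u t *\<^sub>R t) = (if s \<in> T then u s else 0)))"
proof -
  have fin: "finite S" using assms by (rule aff_independent_finite)
  have ex: "\<exists>f. \<exists>k. linear f \<and> (\<forall>t\<in>S. f t + k = (if t = s then 1 else (0::real)))" for s
  proof (cases "S = {}")
    case True
    then show ?thesis by (auto intro: exI[of _ "\<lambda>_. 0"] linear_zero)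
  next
    case False
    then obtain a where "a \<in> S" by blast
    define \<delta> where "\<delta> = (\<lambda>t. if t = s then 1 else (0::real))"
    have "independent ((\<lambda>x. - a + x) ` (S - {a}))"
      using affine_dependent_iff_dependent2[OF \<open>a \<in> S\<close>] assms by blast
    then obtain f where f: "linear f"
      "\<forall>w\<in>(\<lambda>x. - a + x) ` (S - {a}). f w = \<delta> (a + w) - \<delta> a"
      using linear_independent_extend[of _ "\<lambda>w. \<delta> (a + w) - \<delta> a"] by blast
    have "f t + (\<delta> a - f a) = \<delta> t" if "t \<in> S" for t
    proof (cases "t = a")
      case False
      then have "f (- a + t) = \<delta> t - \<delta> a" using f(2) that by auto
      then show ?thesis using f(1) by (simp add: linear_diff)
    qed auto
    then show ?thesis using f(1) unfolding \<delta>_def by blast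
  qed
  then obtain f k where fk: "\<And>s. linear (f s)"
    "\<And>s t. t \<in> S \<Longrightarrow> f s t + k s = (if t = s then 1 else (0::real))"
    by metis
  define c where "c = (\<lambda>s y. f s y + k s)"
  show ?thesis
  proof (intro exI[of _ c] conjI allI impI ballI)
    show "continuous_on UNIV (c s)" for s
      unfolding c_def using fk(1) by (intro continuous_intros linear_continuous_on)
        (simp add: linear_conv_bounded_linear)
    fix T and u :: "'b \<Rightarrow> real" and s assume T: "T \<subseteq> S" "sum u T = 1" "s \<in> S"
    have "finite T" using fin T(1) finite_subset by blast
    have "c s (\<Sum>t\<in>T. u t *\<^sub>R t) = (\<Sum>t\<in>T. u t * f s t) + (\<Sum>t\<in>T. u t) * k s"
      using fk(1)[of s] T(2) by (simp add: c_def linear_sum linear_scale)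
    also have "\<dots> = (\<Sum>t\<in>T. u t * (f s t + k s))"
      by (simp add: sum.distrib sum_distrib_right distrib_left)
    also have "\<dots> = (\<Sum>t\<in>T. if t = s then u t else 0)"
      using fk(2)[of _ s] T(1) by (intro sum.cong) auto
    also have "\<dots> = (if s \<in> T then u s else 0)"
      using \<open>finite T\<close> by simp
    finally show "c s (\<Sum>t\<in>T. u t *\<^sub>R t) = (if s \<in> T then u s else 0)" .
  qed
qed

text \<open>
  Near the point \<open>x\<close> of the common facet, the union of the two simplices is parametrised by the affine hull
  of the facet and one real parameter \<open>t\<close>: \<open>p + t (v - x)\<close> for \<open>t \<ge> 0\<close> and
  \<open>p - t (w - x)\<close> for \<open>t \<le> 0\<close>, where \<open>p\<close> ranges over the affine hull of the facet. In terms of the point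
  \<open>y = p + t (v - x)\<close> of the affine hull of the first simplex, whose barycentric coordinate at \<open>v\<close> is \<open>t\<close>,
  this is a map that adds a multiple of \<open>v + w - 2 x\<close> to \<open>y\<close>.
\<close>

lemma two_simplices_chart:
  fixes P :: "'b::euclidean_space set"
  assumes v: "\<not> affine_dependent (insert v P)" "v \<notin> P"
    and w: "\<not> affine_dependent (insert w P)" "w \<notin> P"
    and vw: "convex hull insert v P \<inter> convex hull insert w P = convex hull P"
    and x: "x \<in> rel_interior (convex hull P)"
  obtains U \<phi> where "openin (top_of_set (affine hull insert v P)) U" "x \<in> U" "\<phi> x = x"
    "continuous_on U \<phi>" "inj_on \<phi> U"
    "\<phi> ` U \<subseteq> convex hull insert v P \<union> convex hull insert w P"
proof -
  obtain c where c: "\<forall>s. continuous_on UNIV (c s)"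
    and cT: "\<forall>T u. T \<subseteq> insert v P \<longrightarrow> sum u T = 1 \<longrightarrow>
      (\<forall>s\<in>insert v P. c s (\<Sum>t\<in>T. u t *\<^sub>R t) = (if s \<in> T then u s else (0::real)))"
    using barycentric_coordinates[OF v(1)] by (elim exE conjE) (rule that)
  obtain c' where c'T: "\<forall>T u. T \<subseteq> insert w P \<longrightarrow> sum u T = 1 \<longrightarrow>
      (\<forall>s\<in>insert w P. c' s (\<Sum>t\<in>T. u t *\<^sub>R t) = (if s \<in> T then u s else (0::real)))"
    using barycentric_coordinates[OF w(1)] by (elim exE conjE) (rule that)
  note cT = cT[rule_format] and c'T = c'T[rule_format] and c = c[rule_format]
  have fin: "finite P" using aff_independent_finite[OF v(1)] by simp
  have indP: "\<not> affine_dependent P"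
    using affine_independent_subset[OF v(1)] by blast
  obtain \<mu> where \<mu>: "\<And>u. u \<in> P \<Longrightarrow> \<mu> u > 0" "sum \<mu> P = 1" "x = (\<Sum>u\<in>P. \<mu> u *\<^sub>R u)"
    using x unfolding rel_interior_convex_hull_explicit[OF indP] by auto
  define a where "a = c v"
  define \<phi> where "\<phi> = (\<lambda>y. y + ((\<bar>a y\<bar> - a y) / 2) *\<^sub>R (v + w - 2 *\<^sub>R x))"
  \<comment> \<open>On \<open>U\<close> the image of \<open>y\<close> has positive coordinates at the vertices of the facet: the coordinate at \<open>u\<close>
    is \<open>c u y\<close> when \<open>a y \<ge> 0\<close> and \<open>c u y + 2 (a y) (\<mu> u)\<close> when \<open>a y < 0\<close>.\<close>
  define U where "U = {y \<in> affine hull insert v P. \<forall>u\<in>P. c u y + (a y - \<bar>a y\<bar>) * \<mu> u > 0}"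
  have ca: "continuous_on UNIV a" unfolding a_def by (rule c)
  have cx: "c u x = \<mu> u" if "u \<in> P" for u
    using cT[of P \<mu> u] \<mu> that by auto
  have ax: "a x = 0"
    using cT[of P \<mu> v] \<mu> v(2) by (auto simp: a_def)
  have expand: "y = (\<Sum>u\<in>P. c u y *\<^sub>R u) + a y *\<^sub>R v \<and> (\<Sum>u\<in>P. c u y) + a y = 1"
    if y: "y \<in> affine hull insert v P" for y
  proof -
    obtain u where u: "sum u (insert v P) = 1" "(\<Sum>t\<in>insert v P. u t *\<^sub>R t) = y"
      using y unfolding affine_hull_finite[OF finite.insertI[OF fin]] by blast
    then have "c s y = u s" if "s \<in> insert v P" for s
      using cT[OF order_refl u(1) that] that by simp
    then have "c v y = u v" "\<And>s. s \<in> P \<Longrightarrow> c s y = u s" by auto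
    then show ?thesis using u v(2) fin by (simp add: a_def add.commute)
  qed
  have nonneg: "\<phi> y = y \<and> y \<in> convex hull insert v P" if "y \<in> U" "a y \<ge> 0" for y
  proof -
    have y: "y \<in> affine hull insert v P" "\<forall>u\<in>P. c u y > 0"
      using that by (auto simp: U_def)
    define \<alpha> where "\<alpha> = (\<lambda>t. c t y)"
    have "y = (\<Sum>t\<in>insert v P. \<alpha> t *\<^sub>R t)" "sum \<alpha> (insert v P) = 1"
      using expand[OF y(1)] v(2) fin by (auto simp: a_def \<alpha>_def add.commute)
    moreover have "\<forall>t\<in>insert v P. \<alpha> t \<ge> 0"
      using y(2) that(2) by (auto simp: a_def \<alpha>_def less_imp_le)
    ultimately have "y \<in> convex hull insert v P"
      unfolding convex_hull_finite[OF finite.insertI[OF fin]] by blast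
    then show ?thesis using that(2) by (simp add: \<phi>_def)
  qed
  have neg: "\<phi> y \<in> convex hull insert w P \<and> c' w (\<phi> y) = - a y" if "y \<in> U" "a y < 0" for y
  proof -
    have y: "y \<in> affine hull insert v P" "\<forall>u\<in>P. c u y + 2 * a y * \<mu> u > 0"
      using that by (auto simp: U_def)
    define \<beta> where "\<beta> = (\<lambda>t. if t = w then - a y else c t y + 2 * a y * \<mu> t)"
    have "\<phi> y = y - a y *\<^sub>R v - a y *\<^sub>R w + (2 * a y) *\<^sub>R x"
      using that(2) by (simp add: \<phi>_def algebra_simps)
    also have "\<dots> = (\<Sum>u\<in>P. c u y *\<^sub>R u) + (2 * a y) *\<^sub>R (\<Sum>u\<in>P. \<mu> u *\<^sub>R u) - a y *\<^sub>R w"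
      using expand[OF y(1)] \<mu>(3) by (simp add: algebra_simps)
    also have "\<dots> = (\<Sum>u\<in>P. (c u y + 2 * a y * \<mu> u) *\<^sub>R u) - a y *\<^sub>R w"
      by (simp add: scaleR_sum_right sum.distrib[symmetric] algebra_simps)
    also have "(\<Sum>u\<in>P. (c u y + 2 * a y * \<mu> u) *\<^sub>R u) = (\<Sum>u\<in>P. \<beta> u *\<^sub>R u)"
      using w(2) by (intro sum.cong) (auto simp: \<beta>_def)
    also have "(\<Sum>u\<in>P. \<beta> u *\<^sub>R u) - a y *\<^sub>R w = (\<Sum>t\<in>insert w P. \<beta> t *\<^sub>R t)"
      using w(2) fin by (simp add: \<beta>_def)
    finally have eq: "\<phi> y = (\<Sum>t\<in>insert w P. \<beta> t *\<^sub>R t)" .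
    have "(\<Sum>u\<in>P. \<beta> u) = (\<Sum>u\<in>P. c u y + 2 * a y * \<mu> u)"
      using w(2) by (intro sum.cong) (auto simp: \<beta>_def)
    also have "\<dots> = 1 + a y"
      using expand[OF y(1)] \<mu>(2) by (simp add: sum.distrib sum_distrib_left[symmetric])
    finally have one: "sum \<beta> (insert w P) = 1"
      using w(2) fin by (simp add: \<beta>_def)
    moreover have "\<forall>t\<in>insert w P. \<beta> t \<ge> 0"
    proof
      fix t assume "t \<in> insert w P"
      then have "t = w \<or> t \<noteq> w \<and> t \<in> P" by blast
      then show "\<beta> t \<ge> 0"
        using bspec[OF y(2), of t] that(2) unfolding \<beta>_def by (elim disjE) simp_all
    qed
    ultimately have "\<phi> y \<in> convex hull insert w P"
      unfolding convex_hull_finite[OF finite.insertI[OF fin]] mem_Collect_eq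
      by (intro exI[of _ \<beta>] conjI eq[symmetric])
    moreover have "c' w (\<phi> y) = - a y"
      using c'T[OF order_refl one, of w] by (simp add: eq \<beta>_def)
    ultimately show ?thesis by blast
  qed
  have c'0: "c' w q = 0" if "q \<in> convex hull P" for q
  proof -
    obtain u where "sum u P = 1" "(\<Sum>t\<in>P. u t *\<^sub>R t) = q"
      using \<open>q \<in> convex hull P\<close> fin by (auto simp: convex_hull_finite)
    then show ?thesis using c'T[of P u w] w(2) by auto
  qed
  \<comment> \<open>A common value of the two branches lies in both simplices, hence in their common facet, where the
    coordinate at \<open>w\<close> vanishes.\<close>
  have mixed: False if "y \<in> U" "z \<in> U" "\<phi> y = \<phi> z" "a y \<ge> 0" "a z < 0" for y z
  proof -
    have "\<phi> z \<in> convex hull P"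
      using nonneg[OF that(1,4)] neg[OF that(2,5)] that(3) vw by auto
    then show False using c'0 neg[OF that(2,5)] that(5) by auto
  qed
  show ?thesis
  proof (rule that[of U \<phi>])
    have "continuous_on UNIV (\<lambda>y. c u y + (a y - \<bar>a y\<bar>) * \<mu> u)" for u
      using c ca by (intro continuous_intros) auto
    then have "open {y. c u y + (a y - \<bar>a y\<bar>) * \<mu> u > 0}" for u
      by (intro open_Collect_less continuous_on_const)
    then have "open (\<Inter>u\<in>P. {y. c u y + (a y - \<bar>a y\<bar>) * \<mu> u > 0})"
      using fin by (intro open_INT ballI)
    then have "openin (top_of_set (affine hull insert v P))
      (affine hull insert v P \<inter> (\<Inter>u\<in>P. {y. c u y + (a y - \<bar>a y\<bar>) * \<mu> u > 0}))"
      by (rule openin_open_Int)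
    also have "(affine hull insert v P \<inter> (\<Inter>u\<in>P. {y. c u y + (a y - \<bar>a y\<bar>) * \<mu> u > 0})) = U"
      unfolding U_def by (rule set_eqI) (simp only: Int_iff INT_iff mem_Collect_eq)
    finally show "openin (top_of_set (affine hull insert v P)) U" .
    have "x \<in> affine hull insert v P"
      using x rel_interior_subset convex_hull_subset_affine_hull hull_mono[of P "insert v P" affine]
      by blast
    then show "x \<in> U" using cx ax \<mu>(1) by (simp add: U_def)
    show "\<phi> x = x" by (simp add: \<phi>_def ax)
    show "continuous_on U \<phi>"
      unfolding \<phi>_def using continuous_on_subset[OF ca] by (intro continuous_intros) auto
    show "inj_on \<phi> U"
    proof (rule inj_onI)
      fix y z assume yz: "y \<in> U" "z \<in> U" "\<phi> y = \<phi> z"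
      consider "a y \<ge> 0" "a z \<ge> 0" | "a y < 0" "a z < 0" | "a y \<ge> 0" "a z < 0" | "a y < 0" "a z \<ge> 0"
        by linarith
      then show "y = z"
      proof cases
        case 1 then show ?thesis using nonneg yz by metis
      next
        case 2
        then have "a y = a z" using neg yz by (metis neg_equal_iff_equal)
        then show ?thesis using yz(3) by (simp add: \<phi>_def)
      qed (use mixed yz in metis)+
    qed
    show "\<phi> ` U \<subseteq> convex hull insert v P \<union> convex hull insert w P"
      using nonneg neg by (metis UnCI image_subsetI linorder_not_less)
  qed
qed

section \<open>Balls in the skeleton of a complex\<close>

lemma rel_interior_subset_affine_hull: "rel_interior S \<subseteq> affine hull S"
  using rel_interior_subset hull_subset by (rule order_trans)

text \<open>
  \<open>X\<close> is a \<open>d\<close>-ball with boundary \<open>B\<close>, presented by a chart from the unit ball of \<open>V\<close>.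
\<close>

locale ball_in_complex =
  fixes C :: "'b::euclidean_space set set" and d :: nat and X B :: "'b set"
    and V :: "'c::euclidean_space set" and F G
  assumes complex: "simplicial_complex C"
    and V: "subspace V" "dim V = d"
    and F: "homeomorphism (cball 0 1 \<inter> V) X F G"
    and FB: "F ` (sphere 0 1 \<inter> V) = B"
    and X: "X \<subseteq> \<Union>{S\<in>C. aff_dim S \<le> int d}"
    and B: "B \<subseteq> \<Union>{S\<in>C. aff_dim S < int d}"
begin

abbreviation tops :: "'b set set"
  where "tops \<equiv> {S\<in>C. aff_dim S = int d \<and> S \<subseteq> X}"

lemma closed_X: "closed X" and closed_B: "closed B" and B_subset: "B \<subseteq> X"
proof -
  have cont: "continuous_on (cball 0 1 \<inter> V) F" and im: "F ` (cball 0 1 \<inter> V) = X"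
    using F by (auto simp: homeomorphism_def)
  have "closed V" using V(1) by (rule closed_subspace)
  then have c: "compact (cball 0 1 \<inter> V)" "compact (sphere 0 1 \<inter> V)"
    by (simp_all add: compact_Int_closed)
  show "closed X" using compact_continuous_image[OF cont c(1)] im by (simp add: compact_imp_closed)
  have "continuous_on (sphere 0 1 \<inter> V) F"
    by (rule continuous_on_subset[OF cont]) auto
  from compact_continuous_image[OF this c(2)] show "closed B"
    by (simp add: FB compact_imp_closed)
  show "B \<subseteq> X" using im FB by auto
qed

lemma eq_top: "S = T" if "S \<in> C" "aff_dim S = int d" "T \<in> C" "aff_dim T = int d" "S \<subseteq> T"
  using complex_eq_if_aff_dim_le[OF complex] that by auto

lemma B_disjoint_top: "rel_interior S \<inter> B = {}" if "S \<in> C" "aff_dim S = int d"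
proof -
  have False if x: "x \<in> rel_interior S" "x \<in> B" for x
  proof -
    obtain T where "T \<in> C" "aff_dim T < int d" "x \<in> T" using x(2) B by auto
    then show False
      using complex_subset_if_rel_interior_point[OF complex \<open>S \<in> C\<close> _ x(1)]
        aff_dim_subset[of S T] \<open>aff_dim S = int d\<close> by auto
  qed
  then show ?thesis by blast
qed

text \<open>
  The trace of \<open>X\<close> on the relative interior of \<open>S\<close> is closed as \<open>X\<close> is compact, and open by invariance
  of domain because it avoids the boundary. The relative interior of \<open>S\<close> is connected.
\<close>

lemma top_subset_if_meets: "S \<subseteq> X"
  if S: "S \<in> C" "aff_dim S = int d" and ne: "rel_interior S \<inter> X \<noteq> {}"
proof -
  define N where "N = rel_interior S \<inter> X"
  have "openin (top_of_set X) N"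
    unfolding N_def using rel_interior_openin_skeleton[OF complex S(1)] X S(2) by simp
  moreover have "N \<inter> F ` (sphere 0 1 \<inter> V) = {}"
    using B_disjoint_top[OF S] by (auto simp: N_def FB)
  moreover have "N \<subseteq> affine hull S"
    using rel_interior_subset_affine_hull[of S] unfolding N_def by blast
  ultimately have "openin (top_of_set (affine hull S)) N"
    using closed_ball_embedding_open_subset(2)[OF V(1) F affine_affine_hull] S(2) V(2) by simp
  moreover have "rel_interior S \<subseteq> affine hull S"
    using rel_interior_subset_affine_hull by blast
  ultimately have "openin (top_of_set (rel_interior S)) N"
    unfolding N_def by (rule openin_subset_trans[OF _ inf_le1])
  moreover have "closedin (top_of_set (rel_interior S)) N"
    unfolding N_def using closed_X by (simp add: closedin_closed_Int)
  moreover have cv: "convex S" using simplicial_complexD(5)[OF complex S(1)] .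
  then have "connected (rel_interior S)"
    by (simp add: convex_connected convex_rel_interior)
  ultimately have "N = rel_interior S"
    using ne unfolding connected_clopen N_def by blast
  then have "rel_interior S \<subseteq> X" by (auto simp: N_def)
  then have "closure (rel_interior S) \<subseteq> X" using closed_X by (rule closure_minimal)
  then show ?thesis
    using convex_closure_rel_interior[OF cv] closure_subset by blast
qed

text \<open>
  A boundary point of the ball can be moved slightly towards the centre.
\<close>

lemma interior_dense: "O' - B \<noteq> {}" if O': "openin (top_of_set X) O'" "O' \<noteq> {}"
proof -
  obtain x where "x \<in> O'" using O'(2) by blast
  have GX: "G ` X = cball 0 1 \<inter> V" and FG: "\<And>y. y \<in> X \<Longrightarrow> F (G y) = y"
    and GF: "\<And>v. v \<in> cball 0 1 \<inter> V \<Longrightarrow> G (F v) = v"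
    using F by (auto simp: homeomorphism_def)
  have OX: "O' \<subseteq> X" using O'(1) openin_imp_subset by blast
  have "openin (top_of_set (cball 0 1 \<inter> V)) (G ` O')"
    using homeomorphism_imp_open_map[OF homeomorphism_symD[OF F] O'(1)] .
  then obtain e where e: "e > 0" "ball (G x) e \<inter> (cball 0 1 \<inter> V) \<subseteq> G ` O'"
    using \<open>x \<in> O'\<close> openin_contains_ball[of "cball 0 1 \<inter> V" "G ` O'"] by blast
  have Gx: "norm (G x) \<le> 1" "G x \<in> V" using GX OX \<open>x \<in> O'\<close> by fastforce+
  \<comment> \<open>Shrinking by the factor \<open>1 - t\<close> moves a vector of norm at most 1 by at most \<open>t\<close>.\<close>
  define t where "t = min (e/2) (1/2)"
  have t: "0 < t" "t < e" "t \<le> 1/2" using e(1) by (auto simp: t_def)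
  define v where "v = (1 - t) *\<^sub>R G x"
  have "dist (G x) v = t * norm (G x)"
    using t by (simp add: v_def dist_norm algebra_simps)
  also have "\<dots> \<le> t" using Gx t by (simp add: mult_left_le)
  finally have d: "dist (G x) v < e" using t by linarith
  have "norm v = (1 - t) * norm (G x)" using t by (simp add: v_def)
  also have "\<dots> \<le> 1 - t" using Gx t by (simp add: mult_left_le)
  finally have n: "norm v < 1" using t by linarith
  have vV: "v \<in> cball 0 1 \<inter> V"
    using n Gx(2) V(1) by (auto simp: v_def subspace_scale)
  then have "v \<in> G ` O'" using e(2) d by auto
  then have "F v \<in> O'" using FG OX by auto
  moreover have "F v \<notin> B"
  proof
    assume "F v \<in> B"
    then obtain w where "w \<in> sphere 0 1 \<inter> V" "F v = F w" using FB by auto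
    then have "v = w" using GF vV by (metis Int_iff sphere_cball subsetD)
    then show False using n \<open>w \<in> sphere 0 1 \<inter> V\<close> by simp
  qed
  ultimately show ?thesis by blast
qed

text \<open>
  Otherwise some nonempty part of \<open>X\<close>, open and off the boundary, contains no point of a \<open>d\<close>-simplex inside
  \<open>X\<close>. Where this part meets a simplex of the largest possible dimension it is locally contained in the affine hull
  of that simplex, so invariance of dimension forces the dimension to be \<open>d\<close>, and then the simplex lies in
  \<open>X\<close> after all.
\<close>

lemma eq_Union_tops: "X = \<Union>tops"
proof (rule ccontr)
  define Y where "Y = \<Union>tops"
  assume "X \<noteq> \<Union>tops"
  then have "X - Y \<noteq> {}" by (auto simp: Y_def)
  have fin: "finite C" using simplicial_complexD(1)[OF complex] .
  have "closed Y"
    unfolding Y_def using fin simplicial_complexD(7)[OF complex] by (intro closed_Union) auto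
  define N0 where "N0 = X - Y - B"
  have "openin (top_of_set X) (X - Y)" 
    using \<open>closed Y\<close> by (metis Diff_eq open_Compl openin_open_Int)
  from interior_dense[OF this \<open>X - Y \<noteq> {}\<close>] have "N0 \<noteq> {}" by (simp add: N0_def)
  have "open (- (Y \<union> B))" using \<open>closed Y\<close> closed_B by (intro open_Compl closed_Un)
  moreover have "N0 = X \<inter> - (Y \<union> B)" by (auto simp: N0_def)
  ultimately have N0: "openin (top_of_set X) N0" by (metis openin_open_Int)
  define \<T> where "\<T> = {T\<in>C. rel_interior T \<inter> N0 \<noteq> {}}"
  have carrier: "\<exists>T\<in>\<T>. y \<in> rel_interior T" if y: "y \<in> N0" for y
  proof -
    obtain S where "S \<in> C" "y \<in> S" using y X unfolding N0_def by blast
    from complex_rel_interior_point[OF complex this]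
    obtain T where "T \<in> C" "y \<in> rel_interior T" by blast
    then show ?thesis using y unfolding \<T>_def by blast
  qed
  have "finite (aff_dim ` \<T>)" "aff_dim ` \<T> \<noteq> {}"
    using fin carrier \<open>N0 \<noteq> {}\<close> by (auto simp: \<T>_def)
  from Max_in[OF this] obtain T where T: "T \<in> \<T>" "aff_dim T = Max (aff_dim ` \<T>)" by auto
  then have Tmax: "\<And>S. S \<in> \<T> \<Longrightarrow> aff_dim S \<le> aff_dim T"
    using \<open>finite (aff_dim ` \<T>)\<close> by simp
  have TC: "T \<in> C" using T by (simp add: \<T>_def)
  have "N0 \<subseteq> \<Union>{S\<in>C. aff_dim S \<le> aff_dim T}"
    using carrier Tmax rel_interior_subset unfolding \<T>_def by blast
  from rel_interior_openin_skeleton[OF complex TC this]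
  have N: "openin (top_of_set X) (rel_interior T \<inter> N0)" (is "openin _ ?N")
    using N0 openin_trans by blast
  have "?N \<noteq> {}" using T by (simp add: \<T>_def)
  moreover have "?N \<inter> F ` (sphere 0 1 \<inter> V) = {}" by (auto simp: FB N0_def)
  moreover have "?N \<subseteq> affine hull T"
    using rel_interior_subset_affine_hull by blast
  ultimately have "int d \<le> aff_dim T"
    using closed_ball_embedding_open_subset(1)[OF V(1) F affine_affine_hull N] V(2) by simp
  moreover obtain y where y: "y \<in> rel_interior T" "y \<in> N0" using \<open>?N \<noteq> {}\<close> by blast
  then obtain S where S: "S \<in> C" "aff_dim S \<le> int d" "y \<in> S" using X by (auto simp: N0_def)
  from complex_subset_if_rel_interior_point[OF complex TC S(1) y(1) S(3)]
  have "aff_dim T \<le> int d" using S(2) aff_dim_subset order_trans by blast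
  ultimately have dT: "aff_dim T = int d" by simp
  have "T \<subseteq> X"
    using y by (intro top_subset_if_meets[OF TC dT]) (auto simp: N0_def)
  then have "y \<in> Y" using TC dT y(1) rel_interior_subset by (force simp: Y_def)
  then show False using y(2) by (simp add: N0_def)
qed

text \<open>
  The image of the chart for two simplices with common facet \<open>R\<close> is open in \<open>X\<close> and misses \<open>B\<close>, again by invariance of domain.
\<close>

lemma two_tops_neighbourhood:
  assumes R: "R \<in> C" "aff_dim R = int d - 1" and x: "x \<in> rel_interior R"
    and S: "S \<in> tops" "R \<subseteq> S" and T: "T \<in> tops" "R \<subseteq> T" and "S \<noteq> T"
  obtains N where "openin (top_of_set X) N" "x \<in> N" "N \<subseteq> S \<union> T" "N \<inter> B = {}"
proof -
  have facet: "\<exists>P v. \<not> affine_dependent (insert v P) \<and> v \<notin> P \<and> Q = convex hull insert v P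
      \<and> R = convex hull P" if Q: "Q \<in> tops" "R \<subseteq> Q" for Q
  proof -
    have QC: "Q \<in> C" "aff_dim Q = int d" using Q by auto
    obtain D where D: "\<not> affine_dependent D" "Q = convex hull D"
      using simplicial_complexD(2)[OF complex QC(1)] unfolding simplex_def by blast
    have "R face_of Q"
      using simplicial_complexD(4)[OF complex R(1) QC(1)] Q(2)
        simplicial_complexD(4)[OF complex QC(1) R(1)] by (simp add: Int_absorb1 Int_absorb2)
    then obtain P where P: "P \<subseteq> D" "R = convex hull P"
      using face_of_convex_hull_affine_independent[OF D(1)] D(2) by metis
    have fD: "finite D" using D(1) aff_independent_finite by blast
    have "int (card D) = int d + 1"
      using aff_dim_affine_independent[OF D(1)] QC(2) D(2) by (simp add: aff_dim_convex_hull)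
    moreover have "int (card P) = int d"
      using aff_dim_affine_independent[OF affine_independent_subset[OF D(1) P(1)]] R(2) P(2)
      by (simp add: aff_dim_convex_hull)
    ultimately have "card (D - P) = 1"
      using P(1) fD by (simp add: card_Diff_subset finite_subset)
    then obtain v where "D - P = {v}" by (metis card_1_singletonE)
    then have "D = insert v P" "v \<notin> P" using P(1) by auto
    then show ?thesis using D P by metis
  qed
  obtain P v where v: "\<not> affine_dependent (insert v P)" "v \<notin> P" "S = convex hull insert v P"
    "R = convex hull P" using facet[OF S] by metis
  obtain P' w where w': "\<not> affine_dependent (insert w P')" "w \<notin> P'" "T = convex hull insert w P'"
    "R = convex hull P'" using facet[OF T] by metis
  have "P = {y. y extreme_point_of R}" "P' = {y. y extreme_point_of R}"
    using extreme_point_of_convex_hull_affine_independent[OF affine_independent_subset[OF v(1)], of P]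
      extreme_point_of_convex_hull_affine_independent[OF affine_independent_subset[OF w'(1)], of P']
      v(4) w'(4) by auto
  then have "P' = P" by (metis (no_types))
  have w: "\<not> affine_dependent (insert w P)" "w \<notin> P" "T = convex hull insert w P"
    using w'(1-3) unfolding \<open>P' = P\<close> by this+
  have SC: "S \<in> C" "aff_dim S = int d" and TC: "T \<in> C" "aff_dim T = int d" using S T by auto
  have face: "S \<inter> T face_of S" using simplicial_complexD(4)[OF complex SC(1) TC(1)] .
  have "S \<inter> T \<noteq> S" using eq_top[OF SC TC] \<open>S \<noteq> T\<close> by blast
  then have "aff_dim (S \<inter> T) < int d"
    using face_of_aff_dim_lt[OF simplicial_complexD(5)[OF complex SC(1)] face] SC(2) by simp
  then have "R = S \<inter> T"
    using complex_eq_if_aff_dim_le[OF complex R(1) simplicial_complexD(3)[OF complex SC(1) face]]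
      R(2) S(2) T(2) by auto
  then have ST: "convex hull insert v P \<inter> convex hull insert w P = convex hull P"
    using v w by simp
  have xP: "x \<in> rel_interior (convex hull P)" using x v(4) by simp
  obtain U \<phi> where U: "openin (top_of_set (affine hull insert v P)) U" "x \<in> U" "\<phi> x = x"
    and \<phi>: "continuous_on U \<phi>" "inj_on \<phi> U" "\<phi> ` U \<subseteq> S \<union> T"
    using two_simplices_chart[OF v(1,2) w(1,2) ST xP] v(3) w(3) by metis
  have W: "aff_dim (affine hull insert v P) = dim V"
    using SC(2) V(2) v(3) by (simp add: aff_dim_convex_hull)
  have sub: "\<phi> ` U \<subseteq> X" using \<phi>(3) S T by auto
  show ?thesis
    using that[of "\<phi> ` U"] \<phi>(3) U(2,3)
      closed_ball_embedding_open_image[OF V(1) F affine_affine_hull W U(1) \<phi>(1,2) sub]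
    by (metis FB image_eqI)
qed

text \<open>
  Two simplices already fill a neighbourhood of \<open>x\<close> in \<open>X\<close>, which leaves no room for the relative interior of a third
  and cannot happen at a boundary point. A single simplex cannot fill a neighbourhood of a point off the
  boundary, because \<open>x\<close> would then be in its relative interior instead of in its facet \<open>R\<close>.
\<close>

proposition card_tops_containing:
  assumes R: "R \<in> C" "aff_dim R = int d - 1" "R \<subseteq> X" and x: "x \<in> rel_interior R"
  shows "card {S\<in>tops. R \<subseteq> S} = (if x \<in> B then 1 else 2)"
proof -
  define P where "P = {S\<in>tops. R \<subseteq> S}"
  have fin: "finite C" using simplicial_complexD(1)[OF complex] .
  have finP: "finite P" unfolding P_def using fin by auto
  have xR: "x \<in> R" using x rel_interior_subset by blast
  have inP: "S \<in> P" if "S \<in> tops" "x \<in> S" for S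
    using that complex_subset_if_rel_interior_point[OF complex R(1) _ x] by (auto simp: P_def)
  have "P \<noteq> {}" using inP R(3) xR eq_Union_tops by blast
  have three: "Q = S \<or> Q = T" if STQ: "S \<in> P" "T \<in> P" "Q \<in> P" "S \<noteq> T" for S T Q
  proof -
    have "S \<in> tops" "R \<subseteq> S" "T \<in> tops" "R \<subseteq> T" using STQ unfolding P_def by blast+
    from two_tops_neighbourhood[OF R(1,2) x this STQ(4)]
    obtain N where N: "openin (top_of_set X) N" "x \<in> N" "N \<subseteq> S \<union> T" "N \<inter> B = {}" .
    obtain O' where O': "open O'" "N = X \<inter> O'" using N(1) by (auto simp: openin_open)
    have Q: "Q \<in> C" "aff_dim Q = int d" "Q \<subseteq> X" "x \<in> Q" using that(3) xR by (auto simp: P_def)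
    have "x \<in> closure (rel_interior Q)"
      using convex_closure_rel_interior[OF simplicial_complexD(5)[OF complex Q(1)]] Q(4) closure_subset
      by blast
    then obtain y where y: "y \<in> rel_interior Q" "y \<in> O'"
      using O' N(2) closure_iff_nhds_not_empty[of x "rel_interior Q"] by blast
    then have "y \<in> S \<union> T" using N(3) O'(2) Q(3) rel_interior_subset by blast
    then have "Q \<subseteq> S \<or> Q \<subseteq> T"
      using complex_subset_if_rel_interior_point[OF complex Q(1) _ y(1)] that(1,2)
      by (auto simp: P_def)
    then show ?thesis using eq_top[OF Q(1,2)] that(1,2) by (auto simp: P_def)
  qed
  show ?thesis
  proof (cases "x \<in> B")
    case True
    have "S = T" if "S \<in> P" "T \<in> P" for S T
    proof (rule ccontr)
      assume "S \<noteq> T"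
      have "S \<in> tops" "R \<subseteq> S" "T \<in> tops" "R \<subseteq> T" using that unfolding P_def by blast+
      from two_tops_neighbourhood[OF R(1,2) x this \<open>S \<noteq> T\<close>]
      obtain N where "openin (top_of_set X) N" "x \<in> N" "N \<subseteq> S \<union> T" "N \<inter> B = {}" .
      then show False using True by blast
    qed
    then have "\<exists>S. P = {S}" using \<open>P \<noteq> {}\<close> by blast
    then show ?thesis unfolding P_def[symmetric] using True by auto
  next
    case False
    obtain S where S: "S \<in> P" using \<open>P \<noteq> {}\<close> by blast
    have "P \<noteq> {S}"
    proof
      assume PS: "P = {S}"
      define Y where "Y = \<Union>(tops - {S})"
      have "closed Y"
        unfolding Y_def using fin simplicial_complexD(7)[OF complex] by (intro closed_Union) auto
      have SC: "S \<in> C" "aff_dim S = int d" "S \<subseteq> X" "R \<subseteq> S" using S by (auto simp: P_def)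
      define N where "N = X - (Y \<union> B)"
      have "openin (top_of_set X) N"
        unfolding N_def using \<open>closed Y\<close> closed_B by (metis Diff_eq closed_Un open_Compl openin_open_Int)
      moreover have "N \<inter> F ` (sphere 0 1 \<inter> V) = {}" by (auto simp: N_def FB)
      moreover have NS: "N \<subseteq> S" using eq_Union_tops unfolding N_def Y_def by blast
      moreover have "S \<subseteq> affine hull S" by (rule hull_subset)
      ultimately have "openin (top_of_set (affine hull S)) N"
        using closed_ball_embedding_open_subset(2)[OF V(1) F affine_affine_hull, of N S] SC(2) V(2)
        by auto
      then have "N \<subseteq> rel_interior S" using NS rel_interior_maximal by blast
      moreover have "x \<notin> Y" using inP PS unfolding Y_def by blast
      then have "x \<in> N" using xR R(3) False by (auto simp: N_def)
      ultimately have "x \<in> rel_interior S" by blast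
      then have "S \<subseteq> R"
        using complex_subset_if_rel_interior_point[OF complex SC(1) R(1)] xR by blast
      then show False using aff_dim_subset[of S R] SC(2) R(2) by simp
    qed
    then obtain T where T: "T \<in> P" "T \<noteq> S" using S by blast
    then have "P = {S, T}" using three[OF S T(1)] S by blast
    then show ?thesis unfolding P_def[symmetric] using T(2) False by simp
  qed
qed

end

section \<open>Alternating labels\<close>

lemma finite_has_maximal_value:
  fixes f :: "'v \<Rightarrow> int"
  assumes "finite W" "W \<noteq> {}"
  shows "\<exists>u\<in>W. \<forall>v\<in>W. f v \<le> f u"
proof -
  have "Max (f ` W) \<in> f ` W" using assms by (intro Max_in) auto
  then obtain u where "u \<in> W" "f u = Max (f ` W)" by auto
  moreover have "\<forall>v\<in>W. f v \<le> Max (f ` W)" using assms(1) by simp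
  ultimately show ?thesis by metis
qed

text \<open>
  In the order given by \<open>f\<close>, an element is a cut if \<open>P\<close> holds everywhere below it and nowhere above it. If \<open>P\<close> says that a
  label has the sign which its position prescribes, then deleting a cut leaves an alternating sequence,
  since the elements above it move down by one position.
\<close>

definition cuts :: "('v \<Rightarrow> int) \<Rightarrow> ('v \<Rightarrow> bool) \<Rightarrow> 'v set \<Rightarrow> 'v set"
  where "cuts f P W = {u\<in>W. \<forall>v\<in>W. (f v < f u \<longrightarrow> P v) \<and> (f u < f v \<longrightarrow> \<not> P v)}"

text \<open>
  Reversing the order and negating \<open>P\<close> exchanges the two sides of a cut, which halves the case distinctions
  below.
\<close>

lemma cuts_uminus: "cuts (\<lambda>v. - f v) (\<lambda>v. \<not> P v) W = cuts f P W"
  by (auto simp: cuts_def)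

lemma card_cuts_all:
  assumes "finite W" "W \<noteq> {}" "inj_on f W" "\<And>v. v \<in> W \<Longrightarrow> P v"
  shows "card (cuts f P W) = 1"
proof -
  obtain u where u: "u \<in> W" "\<forall>v\<in>W. f v \<le> f u"
    using finite_has_maximal_value[OF assms(1,2)] by blast
  have "cuts f P W = {u}"
  proof (intro set_eqI iffI)
    fix x assume x: "x \<in> cuts f P W"
    then have "x \<in> W" "\<not> f x < f u" using assms(4)[OF u(1)] u(1) by (auto simp: cuts_def)
    then have "f x = f u" using u(2) by force
    then show "x \<in> {u}" using assms(3) \<open>x \<in> W\<close> u(1) by (simp add: inj_onD)
  next
    fix x assume "x \<in> {u}"
    then show "x \<in> cuts f P W" using u assms(4) by (auto simp: cuts_def not_less[symmetric])
  qed
  then show ?thesis by simp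
qed

text \<open>
  If a cut exists, \<open>P\<close> holds on an initial segment, and the cuts are the last element of this segment
  and the first one after it.
\<close>

lemma card_cuts_mixed:
  assumes "finite W" "inj_on f W" "z \<in> W" "\<not> P z" "u \<in> cuts f P W" "P u"
  shows "card (cuts f P W) = 2"
proof -
  have u: "u \<in> W" "\<And>v. v \<in> W \<Longrightarrow> f v < f u \<Longrightarrow> P v" "\<And>v. v \<in> W \<Longrightarrow> f u < f v \<Longrightarrow> \<not> P v"
    using assms(5) by (auto simp: cuts_def)
  define A where "A = {v\<in>W. f u < f v}"
  have "f u < f z"
  proof (rule ccontr)
    assume "\<not> f u < f z"
    then have "f z = f u" using u(2)[OF assms(3)] assms(4) by linarith
    then have "z = u" using inj_onD[OF assms(2) _ assms(3) u(1)] by blast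
    then show False using assms(4,6) by simp
  qed
  then have A: "finite A" "A \<noteq> {}" using assms(1,3) by (auto simp: A_def)
  obtain w where w: "w \<in> A" "\<forall>v\<in>A. - f v \<le> - f w"
    using finite_has_maximal_value[OF A, of "\<lambda>v. - f v"] by blast
  have wW: "w \<in> W" "f u < f w" "\<not> P w" using w(1) u(3) by (auto simp: A_def)
  have below: "P v" if "v \<in> W" "f v < f w" for v
  proof -
    have "\<not> f u < f v" using w(2) that by (auto simp: A_def)
    then consider "f v < f u" | "f v = f u" by linarith
    then show ?thesis
    proof cases
      case 1 then show ?thesis using u(2) that(1) by blast
    next
      case 2
      then have "v = u" using inj_onD[OF assms(2) _ that(1) u(1)] by blast
      then show ?thesis using assms(6) by simp
    qed
  qed
  have above: "\<not> P v" if "v \<in> W" "f w < f v" for v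
    using u(3)[OF that(1)] wW(2) that(2) by linarith
  have "cuts f P W = {u, w}"
  proof (intro set_eqI iffI)
    fix x assume x: "x \<in> cuts f P W"
    then have "x \<in> W" by (simp add: cuts_def)
    have "\<not> f x < f u" "\<not> f w < f x"
      using x u(1) assms(6) wW(1,3) by (auto simp: cuts_def)
    then consider "f x = f u" | "f u < f x" "f x \<le> f w" by linarith
    then show "x \<in> {u, w}"
    proof cases
      case 1 then show ?thesis using inj_onD[OF assms(2) _ \<open>x \<in> W\<close> u(1)] by blast
    next
      case 2
      then have "x \<in> A" using \<open>x \<in> W\<close> by (simp add: A_def)
      then have "f x = f w" using w(2) 2(2) by force
      then show ?thesis using inj_onD[OF assms(2) _ \<open>x \<in> W\<close> wW(1)] by blast
    qed
  next
    fix x assume "x \<in> {u, w}"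
    then show "x \<in> cuts f P W" using assms(5) wW(1) below above by (auto simp: cuts_def)
  qed
  moreover have "u \<noteq> w" using wW(2) by auto
  ultimately show ?thesis by simp
qed

lemma card_cuts:
  assumes W: "finite W" "W \<noteq> {}" and inj: "inj_on f W"
  shows "if (\<forall>v\<in>W. P v) \<or> (\<forall>v\<in>W. \<not> P v) then card (cuts f P W) = 1
    else card (cuts f P W) = 0 \<or> card (cuts f P W) = 2"
proof -
  have inj': "inj_on (\<lambda>v. - f v) W" using inj by (auto simp: inj_on_def)
  consider "\<forall>v\<in>W. P v" | "\<forall>v\<in>W. \<not> P v" | "cuts f P W = {}"
    | x y u where "x \<in> W" "P x" "y \<in> W" "\<not> P y" "u \<in> cuts f P W"
    by blast
  then show ?thesis
  proof cases
    case 1 then show ?thesis using card_cuts_all[OF W inj, of P] by simp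
  next
    case 2
    then show ?thesis
      using card_cuts_all[OF W inj', of "\<lambda>v. \<not> P v"] by (simp add: cuts_uminus)
  next
    case 3
    then have "\<not> (\<forall>v\<in>W. P v)" "\<not> (\<forall>v\<in>W. \<not> P v)"
      using card_cuts_all[OF W inj, of P] card_cuts_all[OF W inj', of "\<lambda>v. \<not> P v"]
      by (auto simp: cuts_uminus)
    then show ?thesis using 3 by simp
  next
    case 4
    have "card (cuts f P W) = 2"
    proof (cases "P u")
      case True then show ?thesis using card_cuts_mixed[OF W(1) inj 4(3,4,5)] by blast
    next
      case False
      then show ?thesis
        using card_cuts_mixed[OF W(1) inj', of x "\<lambda>v. \<not> P v" u] 4 by (simp add: cuts_uminus)
    qed
    then show ?thesis using 4 by auto
  qed
qed

text \<open>
  The sign of each label is determined by its rank in the order of absolute values. Unlike an enumeration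
  \<open>k\<close> of the absolute values, ranks are easy to follow when a vertex is deleted.
\<close>

definition alternating_labels :: "('v \<Rightarrow> int) \<Rightarrow> int \<Rightarrow> 'v set \<Rightarrow> bool"
  where "alternating_labels l s W \<longleftrightarrow> inj_on (\<lambda>v. \<bar>l v\<bar>) W \<and>
    (\<forall>v\<in>W. sgn (l v) = s * (- 1) ^ card {u\<in>W. \<bar>l u\<bar> < \<bar>l v\<bar>})"

lemma increasing_upto:
  fixes k :: "nat \<Rightarrow> int"
  assumes "\<forall>i<d. k i < k (Suc i)" "i < j" "j \<le> d"
  shows "k i < k j"
  using assms(2,3)
proof (induction j)
  case (Suc j)
  then show ?case
    using assms(1) by (metis Suc_le_lessD less_Suc_eq less_imp_le order.strict_trans)
qed simp

lemma card_smaller_labels: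
  fixes k :: "nat \<Rightarrow> int"
  assumes inj: "inj_on (\<lambda>v. \<bar>l v\<bar>) W" and im: "(\<lambda>v. \<bar>l v\<bar>) ` W = k ` {..d}"
    and k: "\<forall>i<d. k i < k (Suc i)" and v: "v \<in> W" "\<bar>l v\<bar> = k i" "i \<le> d"
  shows "card {u\<in>W. \<bar>l u\<bar> < \<bar>l v\<bar>} = i"
proof -
  have "card {u\<in>W. \<bar>l u\<bar> < \<bar>l v\<bar>} = card ((\<lambda>v. \<bar>l v\<bar>) ` {u\<in>W. \<bar>l u\<bar> < \<bar>l v\<bar>})"
    using inj by (intro card_image[symmetric]) (auto intro: inj_on_subset)
  also have "(\<lambda>v. \<bar>l v\<bar>) ` {u\<in>W. \<bar>l u\<bar> < \<bar>l v\<bar>} = {y \<in> (\<lambda>v. \<bar>l v\<bar>) ` W. y < k i}"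
    using v(2) by auto
  also have "\<dots> = k ` {..<i}"
    unfolding im
  proof (intro set_eqI iffI)
    fix y assume "y \<in> {y \<in> k ` {..d}. y < k i}"
    then obtain j where j: "y = k j" "j \<le> d" "k j < k i" by auto
    then have "j < i" using increasing_upto[OF k, of i j] v(3) by (metis linorder_cases order.asym)
    then show "y \<in> k ` {..<i}" using j by simp
  qed (use increasing_upto[OF k] v(3) in auto)
  also have "card \<dots> = card {..<i}"
  proof (rule card_image, rule inj_onI)
    fix x y assume "x \<in> {..<i}" "y \<in> {..<i}" "k x = k y"
    then show "x = y"
      using increasing_upto[OF k, of x y] increasing_upto[OF k, of y x] v(3)
      by (cases x y rule: linorder_cases) auto
  qed
  finally show ?thesis by simp
qed

lemma alternating_labels_iff:
  assumes W: "finite W" "card W = d + 1" and s: "s \<in> {1, - 1}"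
  shows "alternating_labels l s W \<longleftrightarrow> (\<exists>k :: nat \<Rightarrow> int. 1 \<le> k 0 \<and> (\<forall>i<d. k i < k (Suc i)) \<and>
    l ` W = (\<lambda>i. s * (- 1) ^ i * k i) ` {..d})"
proof
  assume alt: "alternating_labels l s W"
  then have inj: "inj_on (\<lambda>v. \<bar>l v\<bar>) W"
    and sg: "\<And>v. v \<in> W \<Longrightarrow> sgn (l v) = s * (- 1) ^ card {u\<in>W. \<bar>l u\<bar> < \<bar>l v\<bar>}"
    by (auto simp: alternating_labels_def)
  define M where "M = (\<lambda>v. nat \<bar>l v\<bar>) ` W"
  have "inj_on (\<lambda>v. nat \<bar>l v\<bar>) W"
    using inj by (auto simp: inj_on_def)
  then have cM: "finite M" "card M = Suc d" using W by (auto simp: M_def card_image)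
  obtain h where h: "bij_betw h {..<card M} M" "strict_mono_on {..<card M} h"
    using ex_bij_betw_strict_mono_card[OF cM(1)] by metis
  define k where "k = (\<lambda>i. int (h i))"
  have hM: "h ` {..d} = M" using h(1) by (simp add: bij_betw_def cM(2) lessThan_Suc_atMost)
  have mono: "\<forall>i<d. k i < k (Suc i)"
    using h(2) by (auto simp: k_def cM(2) strict_mono_on_def)
  have im: "(\<lambda>v. \<bar>l v\<bar>) ` W = k ` {..d}"
  proof -
    have "k ` {..d} = int ` M" using hM by (auto simp: k_def image_image[symmetric])
    then show ?thesis by (simp add: M_def image_image)
  qed
  have lab: "l v = s * (- 1) ^ i * k i" if "v \<in> W" "\<bar>l v\<bar> = k i" "i \<le> d" for v i
  proof -
    have "sgn (l v) = s * (- 1) ^ i"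
      using sg[OF that(1)] card_smaller_labels[OF inj im mono that] by simp
    then show ?thesis using that(2) by (metis sgn_mult_abs)
  qed
  have "k 0 \<in> (\<lambda>v. \<bar>l v\<bar>) ` W" using im by auto
  then obtain v0 where v0: "v0 \<in> W" "k 0 = \<bar>l v0\<bar>" by auto
  have "sgn (l v0) \<noteq> 0" unfolding sg[OF v0(1)] using s by auto
  then have "l v0 \<noteq> 0" by auto
  then have "1 \<le> k 0" using v0(2) by linarith
  moreover have "l ` W = (\<lambda>i. s * (- 1) ^ i * k i) ` {..d}"
  proof (intro set_eqI iffI)
    fix y assume "y \<in> l ` W"
    then obtain v where v: "v \<in> W" "y = l v" by auto
    then have "\<bar>l v\<bar> \<in> k ` {..d}" using im by blast
    then obtain i where "i \<le> d" "\<bar>l v\<bar> = k i" by auto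
    then show "y \<in> (\<lambda>i. s * (- 1) ^ i * k i) ` {..d}" using lab[OF v(1)] v(2) by auto
  next
    fix y assume "y \<in> (\<lambda>i. s * (- 1) ^ i * k i) ` {..d}"
    then obtain i where i: "i \<le> d" "y = s * (- 1) ^ i * k i" by auto
    then have "k i \<in> (\<lambda>v. \<bar>l v\<bar>) ` W" using im by auto
    then obtain v where "v \<in> W" "k i = \<bar>l v\<bar>" by auto
    then show "y \<in> l ` W" using lab[of v i] i by auto
  qed
  ultimately show "\<exists>k :: nat \<Rightarrow> int. 1 \<le> k 0 \<and> (\<forall>i<d. k i < k (Suc i)) \<and>
    l ` W = (\<lambda>i. s * (- 1) ^ i * k i) ` {..d}" using mono by blast
next
  assume "\<exists>k :: nat \<Rightarrow> int. 1 \<le> k 0 \<and> (\<forall>i<d. k i < k (Suc i)) \<and>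
    l ` W = (\<lambda>i. s * (- 1) ^ i * k i) ` {..d}"
  then obtain k :: "nat \<Rightarrow> int" where k0: "1 \<le> k 0" and mono: "\<forall>i<d. k i < k (Suc i)"
    and im: "l ` W = (\<lambda>i. s * (- 1) ^ i * k i) ` {..d}" by blast
  have pos: "1 \<le> k i" if "i \<le> d" for i
    using k0 increasing_upto[OF mono, of 0 i] that by (cases "i = 0") auto
  have ab: "\<bar>s * (- 1) ^ i * k i\<bar> = k i" if "i \<le> d" for i
    using pos[OF that] s by (auto simp: abs_mult power_abs)
  have im': "(\<lambda>v. \<bar>l v\<bar>) ` W = k ` {..d}"
  proof -
    have "(\<lambda>v. \<bar>l v\<bar>) ` W = abs ` l ` W" by (simp add: image_image)
    also have "\<dots> = k ` {..d}" unfolding im image_image by (intro image_cong) (auto simp: ab)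
    finally show ?thesis .
  qed
  have "inj_on k {..d}"
  proof (rule inj_onI)
    fix x y assume "x \<in> {..d}" "y \<in> {..d}" "k x = k y"
    then show "x = y"
      using increasing_upto[OF mono, of x y] increasing_upto[OF mono, of y x]
      by (cases x y rule: linorder_cases) auto
  qed
  then have "card ((\<lambda>v. \<bar>l v\<bar>) ` W) = card W" unfolding im' by (simp add: card_image W(2))
  then have inj: "inj_on (\<lambda>v. \<bar>l v\<bar>) W" using W(1) by (simp add: eq_card_imp_inj_on)
  have "sgn (l v) = s * (- 1) ^ card {u\<in>W. \<bar>l u\<bar> < \<bar>l v\<bar>}" if "v \<in> W" for v
  proof -
    have "l v \<in> (\<lambda>i. s * (- 1) ^ i * k i) ` {..d}" using that im by blast
    then obtain i where i: "i \<le> d" "l v = s * (- 1) ^ i * k i" by auto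
    then have "card {u\<in>W. \<bar>l u\<bar> < \<bar>l v\<bar>} = i"
      using card_smaller_labels[OF inj im' mono that _ i(1)] ab by simp
    moreover have "sgn (l v) = s * (- 1) ^ i"
    proof -
      have "sgn (k i) = 1" using pos[OF i(1)] by simp
      moreover have "sgn s = s" using s by auto
      moreover have "sgn ((- 1 :: int) ^ i) = (- 1) ^ i" by (cases "even i") auto
      ultimately show ?thesis by (simp add: i(2) sgn_mult)
    qed
    ultimately show ?thesis by simp
  qed
  then show "alternating_labels l s W" using inj by (simp add: alternating_labels_def)
qed

text \<open>
  If the absolute values are distinct, the vertices to be deleted are the cuts for the property that a
  label has the sign prescribed by \<open>s\<close> and its rank. If two vertices share an absolute value, they carry the same label since
  complementary labels are excluded; only these two can be deleted, and deleting either leaves the same labels.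
\<close>

lemma card_alternating_facets:
  fixes l :: "'v \<Rightarrow> int"
  assumes W: "finite W" "W \<noteq> {}" and nc: "\<And>u v. u \<in> W \<Longrightarrow> v \<in> W \<Longrightarrow> l u + l v \<noteq> 0"
    and s: "s \<in> {1, - 1}"
  defines "D \<equiv> {u\<in>W. alternating_labels l s (W - {u})}"
  shows "if alternating_labels l 1 W \<or> alternating_labels l (- 1) W then card D = 1
    else card D = 0 \<or> card D = 2"
proof (cases "inj_on (\<lambda>v. \<bar>l v\<bar>) W")
  case True
  define r where "r = (\<lambda>v. card {u\<in>W. \<bar>l u\<bar> < \<bar>l v\<bar>})"
  define P where "P = (\<lambda>v. sgn (l v) = s * (- 1) ^ r v)"
  have l0: "l v \<noteq> 0" if "v \<in> W" for v using nc[OF that that] by simp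
  have sg: "sgn (l v) = 1 \<or> sgn (l v) = - 1" if "v \<in> W" for v using l0[OF that] by (simp add: sgn_if)
  have pw: "(- 1 :: int) ^ r v = 1 \<or> (- 1 :: int) ^ r v = - 1" for v by (cases "even (r v)") auto
  have notP: "\<not> P v \<longleftrightarrow> sgn (l v) = - s * (- 1) ^ r v" if "v \<in> W" for v
    using sg[OF that] pw[of v] s by (auto simp: P_def)
  have altW: "alternating_labels l s W \<longleftrightarrow> (\<forall>v\<in>W. P v)"
    using True by (simp add: alternating_labels_def P_def r_def)
  have altW': "alternating_labels l (- s) W \<longleftrightarrow> (\<forall>v\<in>W. \<not> P v)"
    using True notP by (simp add: alternating_labels_def r_def)
  have "alternating_labels l s (W - {u}) \<longleftrightarrow>
      (\<forall>v\<in>W. (\<bar>l v\<bar> < \<bar>l u\<bar> \<longrightarrow> P v) \<and> (\<bar>l u\<bar> < \<bar>l v\<bar> \<longrightarrow> \<not> P v))" if u: "u \<in> W" for u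
  proof -
    have inj: "inj_on (\<lambda>v. \<bar>l v\<bar>) (W - {u})" using True by (auto intro: inj_on_subset)
    have eq: "sgn (l v) = s * (- 1) ^ card {w\<in>W - {u}. \<bar>l w\<bar> < \<bar>l v\<bar>} \<longleftrightarrow>
        (\<bar>l v\<bar> < \<bar>l u\<bar> \<longrightarrow> P v) \<and> (\<bar>l u\<bar> < \<bar>l v\<bar> \<longrightarrow> \<not> P v)" if v: "v \<in> W" "v \<noteq> u" for v
    proof -
      have "\<bar>l v\<bar> \<noteq> \<bar>l u\<bar>" using inj_onD[OF True _ v(1) u] v(2) by blast
      then consider "\<bar>l v\<bar> < \<bar>l u\<bar>" | "\<bar>l u\<bar> < \<bar>l v\<bar>" by linarith
      then show ?thesis
      proof cases
        case 1
        then have "{w\<in>W - {u}. \<bar>l w\<bar> < \<bar>l v\<bar>} = {w\<in>W. \<bar>l w\<bar> < \<bar>l v\<bar>}" by auto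
        then show ?thesis using 1 by (simp add: P_def r_def)
      next
        case 2
        then have "{w\<in>W. \<bar>l w\<bar> < \<bar>l v\<bar>} = insert u {w\<in>W - {u}. \<bar>l w\<bar> < \<bar>l v\<bar>}" using u by auto
        then have "r v = Suc (card {w\<in>W - {u}. \<bar>l w\<bar> < \<bar>l v\<bar>})"
          unfolding r_def using W(1) by (simp add: card_insert_if)
        then show ?thesis using 2 notP[OF v(1)] by simp
      qed
    qed
    have "alternating_labels l s (W - {u}) \<longleftrightarrow>
      (\<forall>v\<in>W - {u}. (\<bar>l v\<bar> < \<bar>l u\<bar> \<longrightarrow> P v) \<and> (\<bar>l u\<bar> < \<bar>l v\<bar> \<longrightarrow> \<not> P v))"
      unfolding alternating_labels_def using inj eq by blast
    then show ?thesis by auto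
  qed
  then have "D = cuts (\<lambda>v. \<bar>l v\<bar>) P W" unfolding D_def cuts_def by blast
  moreover have "(alternating_labels l 1 W \<or> alternating_labels l (- 1) W) \<longleftrightarrow>
      (\<forall>v\<in>W. P v) \<or> (\<forall>v\<in>W. \<not> P v)"
    using altW altW' s by auto
  ultimately show ?thesis using card_cuts[OF W True, of P] by simp
next
  case False
  then obtain u w where uw: "u \<in> W" "w \<in> W" "u \<noteq> w" "\<bar>l u\<bar> = \<bar>l w\<bar>"
    by (auto simp: inj_on_def)
  then have luw: "l u = l w" using nc[of u w] by (auto simp: abs_eq_iff)
  have "D \<subseteq> {u, w}"
  proof
    fix x assume "x \<in> D"
    then have "inj_on (\<lambda>v. \<bar>l v\<bar>) (W - {x})" by (simp add: D_def alternating_labels_def)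
    from inj_onD[OF this uw(4)] show "x \<in> {u, w}" using uw(1-3) by auto
  qed
  moreover have "u \<in> D \<longleftrightarrow> w \<in> D"
  proof -
    have "W - {u} \<noteq> {}" using uw by blast
    then have "card (W - {u}) \<noteq> 0" using W(1) by simp
    then obtain d where d: "card (W - {u}) = d + 1" by (cases "card (W - {u})") auto
    then have d': "card (W - {w}) = d + 1" using uw W(1) by simp
    have "l u \<in> l ` (W - {u})" "l w \<in> l ` (W - {w})"
      using uw(1-3) luw by (metis Diff_iff imageI singletonD)+
    then have "l ` (W - {u}) = l ` W" "l ` (W - {w}) = l ` W"
      using uw(1,2) by (metis image_insert insert_Diff insert_absorb)+
    then have "l ` (W - {u}) = l ` (W - {w})" by simp
    then show ?thesis
      using alternating_labels_iff[OF _ d s, of l] alternating_labels_iff[OF _ d' s, of l] W(1) uw(1,2)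
      by (simp add: D_def)
  qed
  ultimately have "D = {} \<or> D = {u, w}" by blast
  then have "card D = 0 \<or> card D = 2" using uw(3) by auto
  then show ?thesis using False by (simp add: alternating_labels_def)
qed


section \<open>Paths in graphs with a reversing symmetry\<close>

text \<open>
  A longest run that has not reached the goal can be continued, since its last node has a second neighbour,
  and that neighbour is new: each earlier node already has all its neighbours on the run. The exception would be a
  run from \<open>a\<close> to \<open>\<iota> a\<close>. Its image under \<open>\<iota>\<close>, read backwards, is again a run from \<open>a\<close>, hence the same one. As
  adjacent nodes have opposite parities and \<open>a\<close>, \<open>\<iota> a\<close> equal ones, the run has a middle node, which \<open>\<iota>\<close> fixes.
\<close>

lemma path_to_goal:
  fixes N :: "'x \<Rightarrow> 'x set" and \<iota> :: "'x \<Rightarrow> 'x" and dim :: "'x \<Rightarrow> nat"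
  assumes sym: "\<And>x y. y \<in> N x \<Longrightarrow> x \<in> N y"
    and fin: "finite S" "\<And>x. N x \<subseteq> S"
    and par: "\<And>x y. y \<in> N x \<Longrightarrow> even (dim y) \<longleftrightarrow> odd (dim x)"
    and \<iota>: "\<And>x y. y \<in> N x \<Longrightarrow> \<iota> y \<in> N (\<iota> x)" "\<And>x. \<iota> (\<iota> x) = x"
      "\<And>x. N x \<noteq> {} \<Longrightarrow> \<iota> x \<noteq> x"
    and \<iota>a: "\<iota> a \<noteq> a" "dim (\<iota> a) = dim a"
    and start: "a \<notin> Goal \<Longrightarrow> card (N a) = 1"
    and inner: "\<And>x. \<lbrakk>x \<notin> Goal; x \<noteq> a; x \<noteq> \<iota> a; N x \<noteq> {}\<rbrakk> \<Longrightarrow> card (N x) = 2"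
  obtains ps where "ps \<noteq> []" "ps ! 0 = a"
    "\<forall>i. Suc i < length ps \<longrightarrow> ps ! i \<notin> Goal \<and> N (ps ! i) - set (take i ps) = {ps ! Suc i}"
    "last ps \<in> Goal"
proof -
  define run where "run = (\<lambda>ps. ps \<noteq> [] \<and> ps ! 0 = a \<and> (\<forall>i. Suc i < length ps \<longrightarrow>
    ps ! i \<notin> Goal \<and> N (ps ! i) - set (take i ps) = {ps ! Suc i}))"
  have step: "ps ! Suc i \<in> N (ps ! i)" "ps ! Suc i \<notin> set (take i ps)"
    if "run ps" "Suc i < length ps" for ps i
    using that by (auto simp: run_def)
  have irrefl: "x \<notin> N x" for x using par by blast
  have ne: "ps ! j \<noteq> ps ! i" if r: "run ps" and ij: "j < i" "i < length ps" for ps i j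
  proof -
    obtain i' where i': "i = Suc i'" using ij(1) by (cases i) auto
    show ?thesis
    proof (cases "j = i'")
      case True
      then show ?thesis using step(1)[OF r, of i'] ij(2) i' irrefl by metis
    next
      case False
      then have "j < i'" using ij(1) i' by simp
      then have "ps ! j \<in> set (take i' ps)"
        using ij(2) i' by (auto simp: in_set_conv_nth intro!: exI[of _ j])
      then show ?thesis using step(2)[OF r, of i'] ij(2) i' by metis
    qed
  qed
  \<comment> \<open>The graph has no chords between nodes of a run.\<close>
  have earlier: "Suc j = i" if r: "run ps" and ij: "j < i" "i < length ps" "ps ! j \<in> N (ps ! i)"
    for ps i j
  proof -
    have "ps ! i \<notin> set (take j ps)"
      using ne[OF r _ ij(2)] ij(1,2) by (auto simp: in_set_conv_nth)
    moreover have "ps ! i \<in> N (ps ! j)" using sym ij(3) .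
    moreover have "N (ps ! j) - set (take j ps) = {ps ! Suc j}"
      using r ij(1,2) by (auto simp: run_def)
    ultimately have "ps ! i = ps ! Suc j" by blast
    then show ?thesis using ne[OF r, of "Suc j" i] ij(1,2) by (metis Suc_lessI)
  qed
  have bound: "length ps \<le> card (insert a S)" if r: "run ps" for ps
  proof -
    have "distinct ps"
      unfolding distinct_conv_nth using ne[OF r] by (metis linorder_neqE_nat)
    moreover have "set ps \<subseteq> insert a S"
    proof
      fix x assume "x \<in> set ps"
      then obtain i where i: "i < length ps" "x = ps ! i" by (auto simp: in_set_conv_nth)
      then show "x \<in> insert a S"
        using r step(1)[OF r, of "i - 1"] fin(2) by (cases i) (auto simp: run_def)
    qed
    ultimately show ?thesis using card_mono[of "insert a S" "set ps"] fin(1) by (simp add: distinct_card)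
  qed
  have "run [a]" by (simp add: run_def)
  then obtain ps where ps: "run ps" and longest: "\<And>qs. run qs \<Longrightarrow> length qs \<le> length ps"
    using ex_has_greatest_nat[of run "[a]" length "Suc (card (insert a S))"] bound
    by (auto simp: less_Suc_eq_le)
  define L where "L = length ps - 1"
  have ps': "ps \<noteq> []" "ps ! 0 = a" "length ps = Suc L"
    using ps by (auto simp: run_def L_def)
  have last: "last ps = ps ! L" using ps'(1) by (simp add: last_conv_nth L_def)
  have "last ps \<in> Goal"
  proof (rule ccontr)
    assume ng: "last ps \<notin> Goal"
    have "\<exists>y. N (ps ! L) - set (take L ps) = {y}"
    proof (cases "L = 0")
      case True
      then show ?thesis using start ng last ps'(2) by (auto simp: card_1_singleton_iff)
    next
      case False
      then obtain L' where L': "L = Suc L'" by (cases L) auto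
      have prev: "ps ! L' \<in> N (ps ! L)" using sym step(1)[OF ps, of L'] ps'(3) L' by simp
      have "ps ! L \<noteq> a" using ne[OF ps, of 0 L] ps'(2,3) L' by simp
      moreover have "ps ! L \<noteq> \<iota> a"
      proof
        assume end_eq: "ps ! L = \<iota> a"
        \<comment> \<open>The mirrored node is a neighbour of \<open>ps ! j\<close>, hence the next node of the run or the previous one; the
          latter is the image of a different node.\<close>
        have mirror: "\<iota> (ps ! (L - i)) = ps ! i" if "i \<le> L" for i
          using that
        proof (induction i rule: less_induct)
          case (less i)
          show ?case
          proof (cases i)
            case 0
            then show ?thesis using end_eq \<iota>(2) ps'(2) by simp
          next
            case (Suc j)
            have *: "L - j = Suc (L - i)" using Suc less.prems by simp
            have "ps ! (L - i) \<in> N (ps ! (L - j))"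
              using sym step(1)[OF ps, of "L - i"] ps'(3) Suc less.prems * by simp
            then have z: "\<iota> (ps ! (L - i)) \<in> N (ps ! j)"
              using \<iota>(1) less.IH[of j] Suc less.prems by fastforce
            have "N (ps ! j) - set (take j ps) = {ps ! i}"
              using ps ps'(3) Suc less.prems by (auto simp: run_def)
            then consider "\<iota> (ps ! (L - i)) = ps ! i" | "\<iota> (ps ! (L - i)) \<in> set (take j ps)"
              using z by blast
            then show ?thesis
            proof cases
              case 2
              then obtain j' where j': "j' < j" "\<iota> (ps ! (L - i)) = ps ! j'"
                by (auto simp: in_set_conv_nth)
              then have "Suc j' = j" using earlier[OF ps j'(1)] z ps'(3) Suc less.prems by simp
              moreover have "\<iota> (ps ! (L - j')) = ps ! j'"
                using less.IH[of j'] j'(1) Suc less.prems by simp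
              then have "ps ! (L - i) = ps ! (L - j')" using j'(2) \<iota>(2) by metis
              moreover have "ps ! (L - i) \<noteq> ps ! (L - j')"
                using ne[OF ps, of "L - i" "L - j'"] ps'(3) j'(1) Suc less.prems by simp
              ultimately show ?thesis by simp
            qed simp
          qed
        qed
        have dims: "even (dim (ps ! i)) \<longleftrightarrow> (even i \<longleftrightarrow> even (dim a))" if "i \<le> L" for i
          using that
        proof (induction i)
          case (Suc i)
          then show ?case using par[OF step(1)[OF ps, of i]] ps'(3) by auto
        qed (simp add: ps'(2))
        have "even L" using dims[of L] end_eq \<iota>a(2) by auto
        then have "L - L div 2 = L div 2" by auto
        then have "\<iota> (ps ! (L div 2)) = ps ! (L div 2)" using mirror[of "L div 2"] by simp
        moreover have "ps ! Suc (L div 2) \<in> N (ps ! (L div 2))"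
          using step(1)[OF ps, of "L div 2"] ps'(3) \<open>even L\<close> L' by auto
        ultimately show False using \<iota>(3) by blast
      qed
      ultimately have "card (N (ps ! L)) = 2" using inner ng last prev by auto
      then obtain y where y: "N (ps ! L) = {ps ! L', y}" "y \<noteq> ps ! L'"
        using prev unfolding card_2_iff by (metis insert_commute insertE singletonD)
      have "y \<notin> set (take L ps)"
      proof
        assume "y \<in> set (take L ps)"
        then obtain j where j: "j < L" "y = ps ! j" by (auto simp: in_set_conv_nth)
        then have "Suc j = L" using earlier[OF ps j(1)] y(1) ps'(3) by simp
        then show False using j(2) y(2) L' by simp
      qed
      moreover have "ps ! L' \<in> set (take L ps)"
        using L' ps'(3) by (auto simp: in_set_conv_nth intro!: exI[of _ L'])
      ultimately have "N (ps ! L) - set (take L ps) = {y}"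
        unfolding y(1) by (simp add: insert_Diff_if)
      then show ?thesis by blast
    qed
    then obtain y where y: "N (ps ! L) - set (take L ps) = {y}" by blast
    have "run (ps @ [y])"
      unfolding run_def
    proof (intro conjI allI impI)
      show "(ps @ [y]) ! 0 = a" using ps' by (simp add: nth_append)
      fix i assume i: "Suc i < length (ps @ [y])"
      then consider "Suc i < length ps" | "i = L" using ps'(3) by fastforce
      then have "ps ! i \<notin> Goal \<and> N (ps ! i) - set (take i ps) = {(ps @ [y]) ! Suc i}"
      proof cases
        case 1
        then show ?thesis using ps by (simp add: run_def nth_append)
      next
        case 2
        then show ?thesis using y ng last ps'(3) by (simp add: nth_append)
      qed
      then show "(ps @ [y]) ! i \<notin> Goal"
        "N ((ps @ [y]) ! i) - set (take i (ps @ [y])) = {(ps @ [y]) ! Suc i}"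
        using i by (simp_all add: nth_append)
    qed simp
    then show False using longest by fastforce
  qed
  then show ?thesis using that[of ps] ps by (auto simp: run_def)
qed

section \<open>Triangulations aligned with hemispheres\<close>

lemma antipode_antipode [simp]: "antipode (antipode A) = A"
  by (simp add: image_image)

lemma antipode_subset_iff [simp]: "antipode A \<subseteq> antipode B \<longleftrightarrow> A \<subseteq> B"
  by (metis antipode_antipode image_mono)

lemma antipode_subset_iff': "antipode A \<subseteq> B \<longleftrightarrow> A \<subseteq> antipode B"
  by (metis antipode_antipode image_mono)

lemma hemisphere_uminus:
  assumes "s \<in> {1, - 1}"
  shows "hemisphere H (- s) d = antipode (hemisphere H s d)"
  using assms by (auto simp: hemisphere_def image_image)

locale aligned_triangulation =
  fixes n :: nat and C :: "'b::euclidean_space set set" and h :: "'b \<Rightarrow> 'a::euclidean_space"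
    and K :: "'a set set" and H :: "nat \<Rightarrow> 'a set"
  assumes dimension: "DIM('a) = n + 1"
    and tri: "triangulates C h (sphere 0 1) K"
    and symmetric_K: "symmetric_triangulation K"
    and aligned: "aligned_with K n H"
begin

abbreviation vert :: "'a set \<Rightarrow> 'a set"
  where "vert \<sigma> \<equiv> \<sigma> \<inter> vertices K"

lemma complex: "simplicial_complex C" and K_eq: "K = (\<lambda>S. h ` S) ` C"
  using tri by (auto simp: triangulates_def)

lemma inj_h: "inj_on h (\<Union>C)" and h_image: "h ` \<Union>C = sphere 0 1"
  using tri by (auto simp: triangulates_def homeomorphism_def intro: inj_on_inverseI)

lemma finite_K: "finite K"
  using simplicial_complexD(1)[OF complex] K_eq by simp

lemma image_subset_iff_C: "h ` S \<subseteq> h ` T \<longleftrightarrow> S \<subseteq> T" if "S \<in> C" "T \<in> C"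
  using inj_on_image_subset_iff[OF inj_h] that by (meson Union_upper)

text \<open>
  A vertex of \<open>K\<close> in the simplex is the image of a point that forms a simplex of \<open>C\<close> by itself. It meets
  \<open>convex hull D\<close> in a face, so it is an extreme point.
\<close>

lemma vert_image:
  assumes "D \<subseteq> \<Union>C" "\<not> affine_dependent D" "convex hull D \<in> C"
  shows "vert (h ` (convex hull D)) = h ` D" "card (vert (h ` (convex hull D))) = card D"
proof -
  show eq: "vert (h ` (convex hull D)) = h ` D"
  proof (intro set_eqI iffI)
    fix v assume "v \<in> vert (h ` (convex hull D))"
    then obtain y where y: "y \<in> convex hull D" "v = h y" and "{v} \<in> K"
      by (auto simp: vertices_def)
    then obtain T where T: "T \<in> C" "h ` T = {v}" by (auto simp: K_eq)
    have yC: "y \<in> \<Union>C" using y(1) assms(3) by blast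
    have "t = y" if "t \<in> T" for t
    proof -
      have "h t = h y" using T(2) that y(2) by auto
      then show ?thesis using inj_onD[OF inj_h _ _ yC] T(1) that by blast
    qed
    moreover have "T \<noteq> {}" using T(2) by auto
    ultimately have "T = {y}" by blast
    then have "convex hull D \<inter> {y} face_of convex hull D"
      using simplicial_complexD(4)[OF complex assms(3), of "{y}"] T(1) by simp
    then have "{y} face_of convex hull D" using y(1) by simp
    then have "y \<in> D"
      using extreme_point_of_convex_hull_affine_independent[OF assms(2)] face_of_singleton by blast
    then show "v \<in> h ` D" using y(2) by simp
  next
    fix v assume "v \<in> h ` D"
    then obtain y where y: "y \<in> D" "v = h y" by auto
    then have "{y} face_of convex hull D"
      using extreme_point_of_convex_hull_affine_independent[OF assms(2)] face_of_singleton by blast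
    then have "{y} \<in> C" using simplicial_complexD(3)[OF complex assms(3)] by blast
    then have "h ` {y} \<in> K" unfolding K_eq by (rule imageI)
    then have "v \<in> vertices K" using y(2) by (simp add: vertices_def)
    then show "v \<in> vert (h ` (convex hull D))" using y hull_inc by (metis IntI image_eqI)
  qed
  show "card (vert (h ` (convex hull D))) = card D"
    unfolding eq by (rule card_image) (rule inj_on_subset[OF inj_h assms(1)])
qed

lemma simplex_cases:
  assumes "\<sigma> \<in> K"
  obtains D where "D \<subseteq> \<Union>C" "\<not> affine_dependent D" "convex hull D \<in> C" "\<sigma> = h ` (convex hull D)"
    "vert \<sigma> = h ` D" "card (vert \<sigma>) = card D"
proof -
  obtain S where S: "S \<in> C" "\<sigma> = h ` S" using assms by (auto simp: K_eq)
  obtain D where D: "\<not> affine_dependent D" "S = convex hull D"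
    using simplicial_complexD(2)[OF complex S(1)] unfolding simplex_def by blast
  have "D \<subseteq> \<Union>C" using hull_subset[of D convex] S(1) D(2) by blast
  then show ?thesis using that[of D] D S vert_image[of D] by simp
qed

lemma finite_vert: "\<sigma> \<in> K \<Longrightarrow> finite (vert \<sigma>)"
  using aff_independent_finite by (metis finite_imageI simplex_cases)

lemma card_vert: "int (card (vert (h ` S))) = aff_dim S + 1" if S: "S \<in> C"
proof -
  have "h ` S \<in> K" using S by (simp add: K_eq)
  then obtain D where D: "D \<subseteq> \<Union>C" "\<not> affine_dependent D" "convex hull D \<in> C"
    "h ` S = h ` (convex hull D)" "vert (h ` S) = h ` D" "card (vert (h ` S)) = card D"
    by (rule simplex_cases)
  have "S = convex hull D"
    using image_subset_iff_C[OF S D(3)] image_subset_iff_C[OF D(3) S] D(4) by blast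
  then show ?thesis
    using D(6) aff_dim_affine_independent[OF D(2)] by (simp add: aff_dim_convex_hull)
qed

lemma image_in_simplices_iff: "h ` S \<in> simplices K d \<longleftrightarrow> aff_dim S = int d" if S: "S \<in> C"
  using card_vert[OF S] S by (auto simp: simplices_def K_eq)

lemma vert_subset_imp_subset:
  assumes "\<sigma> \<in> K" "\<tau> \<in> K" "vert \<sigma> \<subseteq> vert \<tau>"
  shows "\<sigma> \<subseteq> \<tau>"
proof -
  obtain D where D: "D \<subseteq> \<Union>C" "\<sigma> = h ` (convex hull D)" "vert \<sigma> = h ` D"
    using simplex_cases[OF assms(1)] by metis
  obtain E where E: "E \<subseteq> \<Union>C" "\<tau> = h ` (convex hull E)" "vert \<tau> = h ` E"
    using simplex_cases[OF assms(2)] by metis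
  have "h ` D \<subseteq> h ` E" using assms(3) unfolding D(3) E(3) .
  then have "D \<subseteq> E" using inj_on_image_subset_iff[OF inj_h D(1) E(1)] by simp
  then show ?thesis using D E by (simp add: hull_mono image_mono)
qed

lemma inj_on_vert: "inj_on vert K"
  using vert_subset_imp_subset by (auto intro!: inj_onI)

lemma face_exists:
  assumes "\<sigma> \<in> K" "W \<subseteq> vert \<sigma>"
  obtains \<rho> where "\<rho> \<in> K" "\<rho> \<subseteq> \<sigma>" "vert \<rho> = W"
proof -
  obtain D where D: "D \<subseteq> \<Union>C" "\<not> affine_dependent D" "convex hull D \<in> C"
    "\<sigma> = h ` (convex hull D)" "vert \<sigma> = h ` D" "card (vert \<sigma>) = card D"
    using assms(1) by (rule simplex_cases)
  obtain E where E: "E \<subseteq> D" "W = h ` E" using assms(2) D(5) by (metis subset_imageE)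
  have "convex hull E face_of convex hull D"
    using face_of_convex_hull_affine_independent[OF D(2)] E(1) by blast
  then have EC: "convex hull E \<in> C" using simplicial_complexD(3)[OF complex D(3)] by blast
  have "vert (h ` (convex hull E)) = W"
    using vert_image(1)[of E] D(1) E affine_independent_subset[OF D(2) E(1)] EC by blast
  moreover have "h ` (convex hull E) \<in> K" using EC by (simp add: K_eq)
  moreover have "h ` (convex hull E) \<subseteq> \<sigma>" using D(4) E(1) by (simp add: hull_mono image_mono)
  ultimately show ?thesis using that by blast
qed

lemma rel_interior_image_point:
  assumes "S \<in> C" "x \<in> rel_interior S" "\<tau> \<in> K" "h x \<in> \<tau>"
  shows "h ` S \<subseteq> \<tau>"
proof -
  obtain T where T: "T \<in> C" "\<tau> = h ` T" using assms(3) by (auto simp: K_eq)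
  obtain y where y: "y \<in> T" "h x = h y" using assms(4) T(2) by auto
  have "x \<in> S" using assms(2) rel_interior_subset by blast
  then have "x = y" using inj_onD[OF inj_h y(2)] assms(1) T(1) y(1) by blast
  then have "S \<subseteq> T"
    using complex_subset_if_rel_interior_point[OF complex assms(1) T(1) assms(2)] y(1) by blast
  then show ?thesis using T(2) by auto
qed

text \<open>
  Such points replace relative interiors, which have no meaning for the curved simplices of \<open>K\<close>.
\<close>

lemma interior_point:
  assumes "\<sigma> \<in> K" "\<sigma> \<noteq> {}"
  obtains x where "x \<in> \<sigma>" "\<forall>\<tau>\<in>K. x \<in> \<tau> \<longrightarrow> \<sigma> \<subseteq> \<tau>"
proof -
  obtain S where S: "S \<in> C" "\<sigma> = h ` S" using assms(1) by (auto simp: K_eq)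
  then have "rel_interior S \<noteq> {}"
    using assms(2) rel_interior_eq_empty simplicial_complexD(5)[OF complex S(1)] by blast
  then obtain x where x: "x \<in> rel_interior S" by blast
  then have "h x \<in> \<sigma>" using S(2) rel_interior_subset by blast
  then show ?thesis using that rel_interior_image_point[OF S(1) x] S(2) by blast
qed

text \<open>
  The ball is pulled back along \<open>h\<close> to the polyhedron of \<open>C\<close>, where its simplices are straight.
\<close>

lemma ball_structure:
  assumes ball: "ball_with_boundary d A B" and d: "1 \<le> d" "d \<le> n"
    and A: "A \<subseteq> sphere 0 1" "A \<subseteq> skeleton K d" and B: "B \<subseteq> A" "B \<subseteq> skeleton K (d - 1)"
  shows "A = \<Union>{\<sigma>\<in>simplices K d. \<sigma> \<subseteq> A}"
    and "\<rho> \<in> simplices K (d - 1) \<Longrightarrow> \<rho> \<subseteq> A \<Longrightarrow>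
      \<exists>x\<in>\<rho>. (\<forall>\<tau>\<in>K. x \<in> \<tau> \<longrightarrow> \<rho> \<subseteq> \<tau>) \<and>
        card {\<tau>\<in>simplices K d. \<rho> \<subseteq> \<tau> \<and> \<tau> \<subseteq> A} = (if x \<in> B then 1 else 2)"
proof -
  obtain g where g: "homeomorphism (\<Union>C) (sphere 0 1) h g"
    using tri by (auto simp: triangulates_def)
  have hg: "\<And>y. y \<in> sphere 0 1 \<Longrightarrow> h (g y) = y" and gh: "\<And>x. x \<in> \<Union>C \<Longrightarrow> g (h x) = x"
    and gim: "g ` sphere 0 1 = \<Union>C"
    using g by (auto simp: homeomorphism_def)
  have "d \<le> DIM('a)" using d dimension by simp
  from ball_with_boundary_chart[OF ball this]
  obtain V :: "'a set" and F G where V: "subspace V" "dim V = d"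
    and F: "homeomorphism (cball 0 1 \<inter> V) A F G" "F ` (sphere 0 1 \<inter> V) = B" .
  define X where "X = g ` A"
  define Y where "Y = g ` B"
  have XC: "X \<subseteq> \<Union>C" using A(1) gim by (auto simp: X_def)
  have memX: "x \<in> X \<longleftrightarrow> h x \<in> A" if "x \<in> \<Union>C" for x
    using gh[OF that] hg A(1) by (auto simp: X_def image_iff) (metis subsetD)+
  have memY: "x \<in> Y \<longleftrightarrow> h x \<in> B" if "x \<in> \<Union>C" for x
    using gh[OF that] hg A(1) B(1) by (auto simp: Y_def image_iff) (metis subsetD)+
  have hX: "h ` X = A" using hg A(1) by (force simp: X_def image_image)
  have "homeomorphism A X g h"
    using homeomorphism_of_subsets[OF homeomorphism_symD[OF g] A(1) _ X_def[symmetric]] XC by simp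
  from homeomorphism_compose[OF F(1) this]
  have FX: "homeomorphism (cball 0 1 \<inter> V) X (g \<circ> F) (G \<circ> h)" .
  have skel: "\<exists>S\<in>C. aff_dim S \<le> int e \<and> x \<in> S" if x: "x \<in> \<Union>C" "h x \<in> skeleton K e" for x e
  proof -
    obtain e' \<sigma> where \<sigma>: "e' \<le> e" "\<sigma> \<in> simplices K e'" "h x \<in> \<sigma>" using x(2) by (auto simp: skeleton_def)
    then have "\<sigma> \<in> K" by (simp add: simplices_def)
    then obtain S where S: "S \<in> C" "\<sigma> = h ` S" by (auto simp: K_eq)
    then obtain y where y: "y \<in> S" "h x = h y" using \<sigma>(3) by auto
    then have "x = y" using inj_onD[OF inj_h y(2) x(1)] S(1) by blast
    moreover have "aff_dim S = int e'" using image_in_simplices_iff[OF S(1)] \<sigma>(2) S(2) by simp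
    ultimately show ?thesis using \<sigma>(1) S(1) y(1) by (intro bexI[of _ S]) auto
  qed
  interpret ball_in_complex C d X Y V "g \<circ> F" "G \<circ> h"
  proof
    show "simplicial_complex C" by (rule complex)
    show "subspace V" "dim V = d" by (rule V)+
    show "homeomorphism (cball 0 1 \<inter> V) X (g \<circ> F) (G \<circ> h)" by (rule FX)
    show "(g \<circ> F) ` (sphere 0 1 \<inter> V) = Y" by (simp only: image_comp[symmetric] F(2) Y_def)
    show "X \<subseteq> \<Union>{S \<in> C. aff_dim S \<le> int d}"
    proof
      fix x assume "x \<in> X"
      then show "x \<in> \<Union>{S \<in> C. aff_dim S \<le> int d}"
        using skel[of x d] memX[of x] XC A(2) by blast
    qed
    show "Y \<subseteq> \<Union>{S \<in> C. aff_dim S < int d}"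
    proof
      fix x assume x: "x \<in> Y"
      then have "x \<in> \<Union>C" using XC B(1) by (auto simp: X_def Y_def)
      moreover from this have "h x \<in> skeleton K (d - 1)" using memY[of x] x B(2) by blast
      ultimately obtain S where "S \<in> C" "aff_dim S \<le> int (d - 1)" "x \<in> S" using skel by blast
      then show "x \<in> \<Union>{S \<in> C. aff_dim S < int d}" using d(1) by auto
    qed
  qed
  have subA: "h ` S \<subseteq> A \<longleftrightarrow> S \<subseteq> X" if "S \<in> C" for S
    using memX that by blast
  have tops: "{\<sigma>\<in>simplices K d. P \<sigma> \<and> \<sigma> \<subseteq> A} = (\<lambda>S. h ` S) ` {S\<in>tops. P (h ` S)}" for P
  proof (intro set_eqI iffI)
    fix \<sigma> assume \<sigma>: "\<sigma> \<in> {\<sigma>\<in>simplices K d. P \<sigma> \<and> \<sigma> \<subseteq> A}"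
    then have "\<sigma> \<in> K" by (simp add: simplices_def)
    then obtain S where S: "S \<in> C" "\<sigma> = h ` S" by (auto simp: K_eq)
    then have "S \<in> {S\<in>tops. P (h ` S)}" using \<sigma> subA[OF S(1)] image_in_simplices_iff[OF S(1)] by auto
    then show "\<sigma> \<in> (\<lambda>S. h ` S) ` {S\<in>tops. P (h ` S)}" using S(2) by blast
  qed (use subA image_in_simplices_iff in auto)
  show "A = \<Union>{\<sigma>\<in>simplices K d. \<sigma> \<subseteq> A}"
  proof -
    have "A = h ` \<Union>tops" using hX eq_Union_tops by simp
    also have "\<dots> = \<Union>((\<lambda>S. h ` S) ` tops)" by blast
    also have "\<dots> = \<Union>{\<sigma>\<in>simplices K d. \<sigma> \<subseteq> A}" using tops[of "\<lambda>_. True"] by simp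
    finally show ?thesis .
  qed
  show "\<exists>x\<in>\<rho>. (\<forall>\<tau>\<in>K. x \<in> \<tau> \<longrightarrow> \<rho> \<subseteq> \<tau>) \<and>
        card {\<tau>\<in>simplices K d. \<rho> \<subseteq> \<tau> \<and> \<tau> \<subseteq> A} = (if x \<in> B then 1 else 2)"
    if \<rho>: "\<rho> \<in> simplices K (d - 1)" "\<rho> \<subseteq> A"
  proof -
    have "\<rho> \<in> K" using \<rho>(1) by (simp add: simplices_def)
    then obtain R where R: "R \<in> C" "\<rho> = h ` R" by (auto simp: K_eq)
    have dimR: "aff_dim R = int d - 1" using image_in_simplices_iff[OF R(1)] \<rho>(1) R(2) d(1) by auto
    then have "R \<noteq> {}" using d(1) by auto
    then have "rel_interior R \<noteq> {}"
      using rel_interior_eq_empty simplicial_complexD(5)[OF complex R(1)] by blast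
    then obtain x where x: "x \<in> rel_interior R" by blast
    then have xR: "x \<in> R" using rel_interior_subset by blast
    have RX: "R \<subseteq> X" using subA[OF R(1)] \<rho>(2) R(2) by simp
    have "{\<tau>\<in>simplices K d. \<rho> \<subseteq> \<tau> \<and> \<tau> \<subseteq> A} = (\<lambda>S. h ` S) ` {S\<in>tops. \<rho> \<subseteq> h ` S}"
      by (rule tops)
    also have "{S\<in>tops. \<rho> \<subseteq> h ` S} = {S\<in>tops. R \<subseteq> S}"
      using image_subset_iff_C[OF R(1)] R(2) by auto
    finally have eq: "{\<tau>\<in>simplices K d. \<rho> \<subseteq> \<tau> \<and> \<tau> \<subseteq> A} = (\<lambda>S. h ` S) ` {S\<in>tops. R \<subseteq> S}" .
    have "inj_on (\<lambda>S. h ` S) {S\<in>tops. R \<subseteq> S}"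
      using image_subset_iff_C by (intro inj_onI) (metis (no_types, lifting) mem_Collect_eq order_refl subset_antisym)
    then have "card {\<tau>\<in>simplices K d. \<rho> \<subseteq> \<tau> \<and> \<tau> \<subseteq> A} = (if x \<in> Y then 1 else 2)"
      unfolding eq using card_tops_containing[OF R(1) dimR RX x] by (simp add: card_image)
    moreover have "x \<in> Y \<longleftrightarrow> h x \<in> B" using memY R(1) xR by blast
    moreover have "\<forall>\<tau>\<in>K. h x \<in> \<tau> \<longrightarrow> \<rho> \<subseteq> \<tau>"
      using rel_interior_image_point[OF R(1) x] R(2) by blast
    moreover have "h x \<in> \<rho>" using xR R(2) by blast
    ultimately show ?thesis by (intro bexI[of _ "h x"] conjI) simp_all
  qed
qed


lemma antipode_in_K: "\<sigma> \<in> K \<Longrightarrow> antipode \<sigma> \<in> K"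
  using symmetric_K by (simp add: symmetric_triangulation_def)

lemma uminus_in_vertices: "v \<in> vertices K \<Longrightarrow> - v \<in> vertices K"
  using antipode_in_K[of "{v}"] by (simp add: vertices_def)

lemma vert_antipode: "vert (antipode \<sigma>) = antipode (vert \<sigma>)"
  using uminus_in_vertices by force

lemma card_antipode: "card (antipode A) = card A"
  by (intro card_image) (simp add: inj_on_def)

lemma antipode_in_simplices: "antipode \<sigma> \<in> simplices K d \<longleftrightarrow> \<sigma> \<in> simplices K d"
proof -
  have "antipode \<sigma> \<in> simplices K d" if "\<sigma> \<in> simplices K d" for \<sigma>
    using that antipode_in_K by (simp add: simplices_def vert_antipode card_antipode)
  from this[of \<sigma>] this[of "antipode \<sigma>"] show ?thesis by auto
qed

lemma flag: "flag_of_hemispheres n H" and skeleton_H: "d \<le> n \<Longrightarrow> H d \<subseteq> skeleton K d"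
  using aligned by (auto simp: aligned_with_def)

lemma antipode_subset_skeleton: "A \<subseteq> skeleton K d \<Longrightarrow> antipode A \<subseteq> skeleton K d"
proof
  fix x assume A: "A \<subseteq> skeleton K d" and x: "x \<in> antipode A"
  then have "- x \<in> skeleton K d" by auto
  then obtain e \<sigma> where "e \<le> d" "\<sigma> \<in> simplices K e" "- x \<in> \<sigma>" by (auto simp: skeleton_def)
  then have "antipode \<sigma> \<in> simplices K e" "x \<in> antipode \<sigma>" "e \<le> d"
    using antipode_in_simplices by (auto intro: rev_image_eqI)
  then show "x \<in> skeleton K d" unfolding skeleton_def by blast
qed

lemma hemisphere_in_skeleton: "d \<le> n \<Longrightarrow> hemisphere H s d \<subseteq> skeleton K d"
  using skeleton_H antipode_subset_skeleton by (simp add: hemisphere_def)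

lemma hemisphere_in_sphere: "hemisphere H s d \<subseteq> sphere 0 1" if "d \<le> n"
proof -
  have "\<forall>d\<le>n. H d \<subseteq> sphere 0 1"
    using flag unfolding flag_of_hemispheres_def by (elim conjE)
  then have H: "H d \<subseteq> sphere 0 1" using that by simp
  have "antipode (sphere (0 :: 'a) 1) \<subseteq> sphere 0 1" by auto
  with image_mono[OF H] have "antipode (H d) \<subseteq> sphere 0 1" by (rule order_trans)
  then show ?thesis using H by (cases "s = 1") (simp_all add: hemisphere_def)
qed

lemma boundary_eq: "H d \<inter> antipode (H d) = H (d - 1) \<union> antipode (H (d - 1))"
  and hemisphere_ball:
    "ball_with_boundary d (hemisphere H s d) (H (d - 1) \<union> antipode (H (d - 1)))"
  if d: "1 \<le> d" "d \<le> n"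
proof -
  have "\<forall>d. 1 \<le> d \<and> d \<le> n \<longrightarrow>
       ball_with_boundary d (H d) (H d \<inter> antipode (H d)) \<and>
       ball_with_boundary d (antipode (H d)) (H d \<inter> antipode (H d)) \<and>
       H d \<inter> antipode (H d) = H (d - 1) \<union> antipode (H (d - 1)) \<and>
       top_of_set (H (d - 1) \<union> antipode (H (d - 1))) homeomorphic_space nsphere (d - 1)"
    using flag unfolding flag_of_hemispheres_def by (elim conjE)
  from this[rule_format, OF conjI[OF d]]
  have ball: "ball_with_boundary d (H d) (H d \<inter> antipode (H d))"
    "ball_with_boundary d (antipode (H d)) (H d \<inter> antipode (H d))"
    and eq: "H d \<inter> antipode (H d) = H (d - 1) \<union> antipode (H (d - 1))"
    by (auto simp only:)
  show "H d \<inter> antipode (H d) = H (d - 1) \<union> antipode (H (d - 1))" by (rule eq)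
  show "ball_with_boundary d (hemisphere H s d) (H (d - 1) \<union> antipode (H (d - 1)))"
    using ball unfolding eq by (cases "s = 1") (simp_all add: hemisphere_def)
qed

lemma hemisphere_top_structure:
  assumes d: "1 \<le> d" "d \<le> n"
  shows "hemisphere H s d = \<Union>{\<sigma>\<in>simplices K d. \<sigma> \<subseteq> hemisphere H s d}"
    and "\<rho> \<in> simplices K (d - 1) \<Longrightarrow> \<rho> \<subseteq> hemisphere H s d \<Longrightarrow>
      \<exists>x\<in>\<rho>. (\<forall>\<tau>\<in>K. x \<in> \<tau> \<longrightarrow> \<rho> \<subseteq> \<tau>) \<and>
        card {\<tau>\<in>simplices K d. \<rho> \<subseteq> \<tau> \<and> \<tau> \<subseteq> hemisphere H s d}
          = (if x \<in> H (d - 1) \<union> antipode (H (d - 1)) then 1 else 2)"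
proof -
  have B: "H (d - 1) \<union> antipode (H (d - 1)) \<subseteq> hemisphere H s d"
    using boundary_eq[OF d] by (auto simp: hemisphere_def)
  have Bs: "H (d - 1) \<union> antipode (H (d - 1)) \<subseteq> skeleton K (d - 1)"
    using hemisphere_in_skeleton[of "d - 1" 1] hemisphere_in_skeleton[of "d - 1" "- 1"] d
    by (simp add: hemisphere_def)
  note * = ball_structure[OF hemisphere_ball[OF d] d hemisphere_in_sphere[OF d(2)]
      hemisphere_in_skeleton[OF d(2)] B Bs]
  show "hemisphere H s d = \<Union>{\<sigma>\<in>simplices K d. \<sigma> \<subseteq> hemisphere H s d}" by (rule *(1))
  show "\<rho> \<in> simplices K (d - 1) \<Longrightarrow> \<rho> \<subseteq> hemisphere H s d \<Longrightarrow>
      \<exists>x\<in>\<rho>. (\<forall>\<tau>\<in>K. x \<in> \<tau> \<longrightarrow> \<rho> \<subseteq> \<tau>) \<and>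
        card {\<tau>\<in>simplices K d. \<rho> \<subseteq> \<tau> \<and> \<tau> \<subseteq> hemisphere H s d}
          = (if x \<in> H (d - 1) \<union> antipode (H (d - 1)) then 1 else 2)" by (rule *(2))
qed

lemma H0_simplex: obtains x where "H 0 = {x}" "x \<noteq> - x" "H 0 \<in> simplices K 0"
proof -
  have "\<exists>x. H 0 = {x}" using flag unfolding flag_of_hemispheres_def by (elim conjE)
  then obtain x where x: "H 0 = {x}" by blast
  have "x \<in> sphere 0 1" using hemisphere_in_sphere[of 0 1] x by (simp add: hemisphere_def)
  then have "x \<noteq> 0" by auto
  then have "x \<noteq> - x" using eq_neg_iff_add_eq_0 [of x x] scaleR_2[of x] by (metis scaleR_eq_0_iff zero_neq_numeral)
  have "x \<in> skeleton K 0" using skeleton_H[of 0] x by simp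
  then obtain \<sigma> where \<sigma>: "\<sigma> \<in> simplices K 0" "x \<in> \<sigma>" by (auto simp: skeleton_def)
  then have "\<sigma> \<in> K" by (simp add: simplices_def)
  then obtain S where S: "S \<in> C" "\<sigma> = h ` S" by (auto simp: K_eq)
  then have "aff_dim S = 0" using image_in_simplices_iff[OF S(1)] \<sigma>(1) by auto
  then have "\<sigma> = {x}" using S(2) \<sigma>(2) by (auto simp: aff_dim_eq_0)
  then show ?thesis using that[OF x \<open>x \<noteq> - x\<close>] x \<sigma>(1) by simp
qed

lemma hemisphere_eq_Union: "hemisphere H s d = \<Union>{\<sigma>\<in>simplices K d. \<sigma> \<subseteq> hemisphere H s d}"
  if "d \<le> n"
proof (cases "d = 0")
  case True
  obtain x where x: "H 0 = {x}" "x \<noteq> - x" "H 0 \<in> simplices K 0" by (rule H0_simplex)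
  then have "hemisphere H s 0 \<in> simplices K 0"
    using antipode_in_simplices[of "H 0" 0] unfolding hemisphere_def by (cases "s = 1") simp_all
  then show ?thesis using True by blast
next
  case False
  then show ?thesis using hemisphere_top_structure(1)[of d s] that by simp
qed

lemma subset_hemisphere_if_interior_point:
  assumes "d \<le> n" "\<forall>\<tau>\<in>K. x \<in> \<tau> \<longrightarrow> \<sigma> \<subseteq> \<tau>" "x \<in> hemisphere H s d"
  shows "\<sigma> \<subseteq> hemisphere H s d"
proof -
  obtain \<tau> where "\<tau> \<in> simplices K d" "\<tau> \<subseteq> hemisphere H s d" "x \<in> \<tau>"
    using assms(3) hemisphere_eq_Union[OF assms(1), of s] by blast
  then show ?thesis using assms(2) by (auto simp: simplices_def)
qed

lemma subset_H_if_interior_point: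
  assumes "d \<le> n" "\<forall>\<tau>\<in>K. x \<in> \<tau> \<longrightarrow> \<sigma> \<subseteq> \<tau>" "x \<in> H d \<union> antipode (H d)"
  shows "\<sigma> \<subseteq> H d \<or> \<sigma> \<subseteq> antipode (H d)"
  using subset_hemisphere_if_interior_point[of d x \<sigma> 1]
    subset_hemisphere_if_interior_point[of d x \<sigma> "- 1"] assms by (auto simp: hemisphere_def)

text \<open>
  The interior point of \<open>\<rho>\<close> lies on the boundary of the hemisphere exactly if all of \<open>\<rho>\<close> does, because the boundary is
  a union of simplices.
\<close>

lemma card_facet_cofaces:
  assumes d: "d < n" and \<rho>: "\<rho> \<in> simplices K d" "\<rho> \<subseteq> hemisphere H s (Suc d)"
  shows "card {\<tau>\<in>simplices K (Suc d). \<rho> \<subseteq> \<tau> \<and> \<tau> \<subseteq> hemisphere H s (Suc d)}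
    = (if \<rho> \<subseteq> H d \<or> \<rho> \<subseteq> antipode (H d) then 1 else 2)"
proof -
  obtain x where x: "x \<in> \<rho>" "\<forall>\<tau>\<in>K. x \<in> \<tau> \<longrightarrow> \<rho> \<subseteq> \<tau>"
    "card {\<tau>\<in>simplices K (Suc d). \<rho> \<subseteq> \<tau> \<and> \<tau> \<subseteq> hemisphere H s (Suc d)}
      = (if x \<in> H d \<union> antipode (H d) then 1 else 2)"
    using hemisphere_top_structure(2)[of "Suc d" \<rho> s] d \<rho> by auto
  have "x \<in> H d \<union> antipode (H d) \<longleftrightarrow> \<rho> \<subseteq> H d \<or> \<rho> \<subseteq> antipode (H d)"
    using subset_H_if_interior_point[of d x \<rho>] x(1,2) d by (metis UnCI less_imp_le subsetD)
  then show ?thesis using x(3) by simp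
qed

lemma simplex_nonempty: "\<sigma> \<in> simplices K d \<Longrightarrow> \<sigma> \<in> K \<and> \<sigma> \<noteq> {}"
  by (auto simp: simplices_def)

text \<open>
  An interior point of \<open>\<sigma>\<close> lies in some \<open>d\<close>-simplex of the hemisphere, and \<open>\<sigma>\<close> is a face of it.
\<close>

lemma dim_le_if_subset_hemisphere:
  assumes "\<sigma> \<in> simplices K e" "\<sigma> \<subseteq> hemisphere H s d" "d \<le> n"
  shows "e \<le> d"
proof -
  have \<sigma>: "\<sigma> \<in> K" "\<sigma> \<noteq> {}" using simplex_nonempty[OF assms(1)] by auto
  obtain x where x: "x \<in> \<sigma>" "\<forall>\<tau>\<in>K. x \<in> \<tau> \<longrightarrow> \<sigma> \<subseteq> \<tau>"
    using interior_point[OF \<sigma>] .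
  obtain \<tau> where \<tau>: "\<tau> \<in> simplices K d" "x \<in> \<tau>"
    using x(1) assms(2) hemisphere_eq_Union[OF assms(3), of s] by blast
  then have "\<tau> \<in> K" by (simp add: simplices_def)
  then have "card (vert \<sigma>) \<le> card (vert \<tau>)"
    using x(2) \<tau>(2) by (intro card_mono finite_vert) auto
  then show ?thesis using assms(1) \<tau>(1) by (simp add: simplices_def)
qed

lemma dim_le_if_subset_H:
  assumes "\<sigma> \<in> simplices K e" "\<sigma> \<subseteq> H d \<or> \<sigma> \<subseteq> antipode (H d)" "d \<le> n"
  shows "e \<le> d"
  using dim_le_if_subset_hemisphere[of \<sigma> e 1 d] dim_le_if_subset_hemisphere[of \<sigma> e "- 1" d] assms
  by (auto simp: hemisphere_def)

text \<open>
  This makes carriers unique: the intersection of a hemisphere with its antipode consists of the hemispheres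
  of the next lower dimension, and the two points \<open>H 0\<close> and \<open>- H 0\<close> are distinct.
\<close>

lemma subset_both_hemispheres:
  assumes "\<sigma> \<in> K" "\<sigma> \<noteq> {}" "d \<le> n" "\<sigma> \<subseteq> H d" "\<sigma> \<subseteq> antipode (H d)"
  shows "d \<noteq> 0 \<and> (\<sigma> \<subseteq> H (d - 1) \<or> \<sigma> \<subseteq> antipode (H (d - 1)))"
proof -
  have "d \<noteq> 0"
  proof
    assume "d = 0"
    moreover obtain x where "H 0 = {x}" "x \<noteq> - x" "H 0 \<in> simplices K 0" by (rule H0_simplex)
    ultimately have "\<sigma> \<subseteq> {x} \<inter> {- x}" using assms(4,5) by auto
    then show False using \<open>x \<noteq> - x\<close> assms(2) by auto
  qed
  obtain x where x: "x \<in> \<sigma>" "\<forall>\<tau>\<in>K. x \<in> \<tau> \<longrightarrow> \<sigma> \<subseteq> \<tau>"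
    using interior_point[OF assms(1,2)] .
  have "x \<in> H (d - 1) \<union> antipode (H (d - 1))"
    using boundary_eq[of d] assms(3-5) x(1) \<open>d \<noteq> 0\<close> by auto
  then show ?thesis using subset_H_if_interior_point[of "d - 1" x \<sigma>] x(2) assms(3) \<open>d \<noteq> 0\<close> by auto
qed

lemma subset_next_hemisphere:
  assumes "d < n" "\<sigma> \<subseteq> H d \<or> \<sigma> \<subseteq> antipode (H d)"
  shows "\<sigma> \<subseteq> hemisphere H s (Suc d)"
  using boundary_eq[of "Suc d"] assms by (auto simp: hemisphere_def)

lemma subset_top_hemisphere:
  assumes "\<sigma> \<in> K" "\<sigma> \<noteq> {}"
  shows "\<sigma> \<subseteq> H n \<or> \<sigma> \<subseteq> antipode (H n)"
proof -
  obtain x where x: "x \<in> \<sigma>" "\<forall>\<tau>\<in>K. x \<in> \<tau> \<longrightarrow> \<sigma> \<subseteq> \<tau>"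
    using interior_point[OF assms] .
  have "\<sigma> \<subseteq> sphere 0 1" using assms(1) h_image by (auto simp: K_eq)
  moreover have "H n \<union> antipode (H n) = sphere 0 1"
    using flag unfolding flag_of_hemispheres_def by (elim conjE)
  ultimately have "x \<in> H n \<union> antipode (H n)" using x(1) by blast
  then show ?thesis using subset_H_if_interior_point[of n x \<sigma>] x(2) by blast
qed

lemma dim_le: "\<sigma> \<in> simplices K e \<Longrightarrow> e \<le> n"
  using dim_le_if_subset_H[of \<sigma> e n] subset_top_hemisphere[of \<sigma>] simplex_nonempty[of \<sigma> e] by blast

text \<open>
  A self-antipodal simplex in a hemisphere would also lie in its antipode, hence in a hemisphere of
  lower dimension, and so on down to \<open>H 0\<close>.
\<close>

lemma antipode_neq:
  assumes "\<sigma> \<in> K" "\<sigma> \<noteq> {}"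
  shows "antipode \<sigma> \<noteq> \<sigma>"
proof
  assume fixed: "antipode \<sigma> = \<sigma>"
  have "\<not> (\<sigma> \<subseteq> H d \<or> \<sigma> \<subseteq> antipode (H d))" if "d \<le> n" for d
    using that
  proof (induction d)
    case 0
    then show ?case
      using subset_both_hemispheres[OF assms, of 0] fixed antipode_subset_iff'[of \<sigma> "H 0"] by auto
  next
    case (Suc d)
    then show ?case
      using subset_both_hemispheres[OF assms, of "Suc d"] fixed antipode_subset_iff'[of \<sigma> "H (Suc d)"]
      by auto
  qed
  then show False using subset_top_hemisphere[OF assms] by blast
qed

lemma carried_by_iff:
  assumes "\<tau> \<in> simplices K d"
  shows "carried_by H s d \<tau> \<longleftrightarrow> s \<in> {1, - 1} \<and> \<tau> \<subseteq> hemisphere H s d"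
proof -
  have "\<not> \<tau> \<subseteq> H e \<and> \<not> \<tau> \<subseteq> antipode (H e)" if "e < d" for e
    using dim_le_if_subset_H[OF assms, of e] dim_le[OF assms] that by auto
  then show ?thesis by (auto simp: carried_by_def)
qed

end

section \<open>Counting alternating simplices\<close>

locale labelled_triangulation = aligned_triangulation n C h K H
  for n :: nat and C :: "'b::euclidean_space set set" and h :: "'b \<Rightarrow> 'a::euclidean_space"
    and K :: "'a set set" and H :: "nat \<Rightarrow> 'a set" +
  fixes l :: "'a \<Rightarrow> int" and m :: nat
  assumes labels: "labels_in K l m"
    and antisym: "antisymmetric_labelling K l"
    and no_complementary: "\<not> (\<exists>\<sigma>. complementary_edge K l \<sigma>)"
begin

lemma label_nonzero: "v \<in> vertices K \<Longrightarrow> l v \<noteq> 0"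
  using labels by (force simp: labels_in_def)

lemma label_sum_nonzero:
  assumes "\<sigma> \<in> K" "u \<in> vert \<sigma>" "v \<in> vert \<sigma>"
  shows "l u + l v \<noteq> 0"
proof (cases "u = v")
  case True
  then show ?thesis using label_nonzero[of u] assms(2) by auto
next
  case False
  have "{u, v} \<subseteq> vert \<sigma>" using assms by blast
  then obtain \<rho> where \<rho>: "\<rho> \<in> K" "\<rho> \<subseteq> \<sigma>" "vert \<rho> = {u, v}" by (rule face_exists[OF assms(1)])
  then have "\<rho> \<in> simplices K 1" using False by (simp add: simplices_def)
  then show ?thesis using no_complementary \<rho>(3) unfolding complementary_edge_def by blast
qed

lemma alternating_iff:
  "alternating K l s d \<sigma> \<longleftrightarrow> \<sigma> \<in> simplices K d \<and> s \<in> {1, - 1} \<and> alternating_labels l s (vert \<sigma>)"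
proof (cases "\<sigma> \<in> simplices K d \<and> s \<in> {1, - 1}")
  case True
  then have \<sigma>: "finite (vert \<sigma>)" "card (vert \<sigma>) = d + 1"
    using finite_vert by (auto simp: simplices_def)
  show ?thesis
    using alternating_labels_iff[OF \<sigma>, of s l] True unfolding alternating_def by blast
qed (auto simp: alternating_def)

lemma alternatingD:
  assumes "alternating K l s d \<sigma>"
  shows "\<sigma> \<in> simplices K d" "\<sigma> \<in> K" "\<sigma> \<noteq> {}" "s \<in> {1, - 1}" "d \<le> n"
  using assms simplex_nonempty[of \<sigma> d] dim_le[of \<sigma> d] by (auto simp: alternating_iff)

lemma simplices_dim_unique: "\<sigma> \<in> simplices K d \<Longrightarrow> \<sigma> \<in> simplices K e \<Longrightarrow> d = e"
  by (simp add: simplices_def)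

lemma alternating_unique:
  assumes "alternating K l s d \<sigma>" "alternating K l t e \<sigma>"
  shows "s = t" "d = e"
proof -
  show "d = e" using assms simplices_dim_unique[of \<sigma> d e] by (simp add: alternating_iff)
  have "card (vert \<sigma>) \<noteq> 0" using assms(1) by (auto simp: alternating_iff simplices_def)
  then obtain v where v: "v \<in> vert \<sigma>" by (metis card.empty equals0I)
  have rank: "sgn (l v) = r * (- 1) ^ card {u\<in>vert \<sigma>. \<bar>l u\<bar> < \<bar>l v\<bar>}"
    if "alternating_labels l r (vert \<sigma>)" for r
    using conjunct2[OF that[unfolded alternating_labels_def]] v by (rule bspec)
  have "alternating_labels l s (vert \<sigma>)" "alternating_labels l t (vert \<sigma>)"
    using assms by (simp_all add: alternating_iff)
  from rank[OF this(1)] rank[OF this(2)]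
  have "s * (- 1) ^ card {u\<in>vert \<sigma>. \<bar>l u\<bar> < \<bar>l v\<bar>} = t * (- 1) ^ card {u\<in>vert \<sigma>. \<bar>l u\<bar> < \<bar>l v\<bar>}"
    by (rule trans[OF sym])
  then show "s = t" by (cases "even (card {u\<in>vert \<sigma>. \<bar>l u\<bar> < \<bar>l v\<bar>})") auto
qed

lemma alternating_antipode:
  assumes "alternating K l s d \<sigma>"
  shows "alternating K l (- s) d (antipode \<sigma>)"
proof -
  obtain k :: "nat \<Rightarrow> int" where k: "1 \<le> k 0" "\<forall>i<d. k i < k (Suc i)"
    "l ` vert \<sigma> = (\<lambda>i. s * (- 1) ^ i * k i) ` {..d}"
    using assms by (auto simp: alternating_def)
  have "l (- v) = - l v" if "v \<in> vert \<sigma>" for v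
    using antisym that by (auto simp: antisymmetric_labelling_def add_eq_0_iff)
  then have "l ` vert (antipode \<sigma>) = uminus ` (l ` vert \<sigma>)"
    unfolding vert_antipode image_image by (rule image_cong[OF refl])
  also have "\<dots> = (\<lambda>i. - s * (- 1) ^ i * k i) ` {..d}"
    unfolding k(3) image_image by simp
  finally have "l ` vert (antipode \<sigma>) = (\<lambda>i. - s * (- 1) ^ i * k i) ` {..d}" .
  then show ?thesis
    using assms k(1,2) antipode_in_simplices[of \<sigma> d] unfolding alternating_def by auto
qed

lemma alternating_vertex:
  assumes "\<sigma> \<in> simplices K 0"
  obtains s where "alternating K l s 0 \<sigma>"
proof -
  have "card (vert \<sigma>) = 1" using assms by (simp add: simplices_def)
  then obtain v where v: "vert \<sigma> = {v}" by (metis card_1_singletonE)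
  then have "l v \<noteq> 0" using label_nonzero by blast
  moreover have "{u\<in>{v}. \<bar>l u\<bar> < \<bar>l v\<bar>} = {}" by auto
  ultimately have "alternating_labels l (sgn (l v)) (vert \<sigma>)" "sgn (l v) \<in> {1, - 1}"
    unfolding v alternating_labels_def by (simp_all only: inj_on_def ball_simps) (auto simp: sgn_if)
  then show ?thesis using that[of "sgn (l v)"] assms by (simp add: alternating_iff)
qed

text \<open>
  Facets of \<open>\<tau>\<close> correspond to the vertices that they omit.
\<close>

lemma card_facets_alternating:
  assumes \<tau>: "\<tau> \<in> simplices K (Suc e)" and s: "s \<in> {1, - 1}"
  shows "if \<exists>t. alternating K l t (Suc e) \<tau> then card {\<rho>. alternating K l s e \<rho> \<and> \<rho> \<subseteq> \<tau>} = 1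
    else card {\<rho>. alternating K l s e \<rho> \<and> \<rho> \<subseteq> \<tau>} = 0 \<or> card {\<rho>. alternating K l s e \<rho> \<and> \<rho> \<subseteq> \<tau>} = 2"
proof -
  have \<tau>K: "\<tau> \<in> K" and card: "card (vert \<tau>) = e + 2" using \<tau> by (auto simp: simplices_def)
  have fin: "finite (vert \<tau>)" using finite_vert[OF \<tau>K] .
  define R where "R = {\<rho>. alternating K l s e \<rho> \<and> \<rho> \<subseteq> \<tau>}"
  define D where "D = {u\<in>vert \<tau>. alternating_labels l s (vert \<tau> - {u})}"
  have RK: "R \<subseteq> K" by (auto simp: R_def alternating_iff simplices_def)
  have "vert ` R = (\<lambda>u. vert \<tau> - {u}) ` D"
  proof (intro set_eqI iffI)
    fix W assume "W \<in> vert ` R"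
    then obtain \<rho> where \<rho>: "\<rho> \<in> simplices K e" "alternating_labels l s (vert \<rho>)" "\<rho> \<subseteq> \<tau>" "W = vert \<rho>"
      by (auto simp: R_def alternating_iff)
    have sub: "vert \<rho> \<subseteq> vert \<tau>" using \<rho>(3) by blast
    have "card (vert \<tau> - vert \<rho>) = 1"
      using card_Diff_subset[OF finite_subset[OF sub fin] sub] card \<rho>(1) by (simp add: simplices_def)
    then obtain u where u: "vert \<tau> - vert \<rho> = {u}" by (metis card_1_singletonE)
    then have "vert \<rho> = vert \<tau> - {u}" "u \<in> vert \<tau>" using sub by blast+
    then show "W \<in> (\<lambda>u. vert \<tau> - {u}) ` D" using \<rho>(2,4) by (auto simp: D_def)
  next
    fix W assume "W \<in> (\<lambda>u. vert \<tau> - {u}) ` D"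
    then obtain u where u: "u \<in> vert \<tau>" "alternating_labels l s (vert \<tau> - {u})" "W = vert \<tau> - {u}"
      by (auto simp: D_def)
    obtain \<rho> where \<rho>: "\<rho> \<in> K" "\<rho> \<subseteq> \<tau>" "vert \<rho> = W"
      using face_exists[OF \<tau>K, of W] u(3) by blast
    have "card W = e + 1" unfolding u(3) using card fin u(1) by simp
    then have "\<rho> \<in> R" using \<rho> u s by (simp add: R_def alternating_iff simplices_def)
    then show "W \<in> vert ` R" using \<rho>(3) by blast
  qed
  moreover have "card (vert ` R) = card R"
    using RK by (intro card_image) (rule inj_on_subset[OF inj_on_vert])
  moreover have "card ((\<lambda>u. vert \<tau> - {u}) ` D) = card D"
    by (intro card_image) (auto simp: inj_on_def D_def)
  ultimately have "card R = card D" by simp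
  moreover have "(\<exists>t. alternating K l t (Suc e) \<tau>) \<longleftrightarrow>
      alternating_labels l 1 (vert \<tau>) \<or> alternating_labels l (- 1) (vert \<tau>)"
    using \<tau> by (auto simp: alternating_iff)
  moreover have "vert \<tau> \<noteq> {}" using card by auto
  note card_alternating_facets[OF fin this label_sum_nonzero[OF \<tau>K] s]
  ultimately show ?thesis unfolding R_def[symmetric] D_def by presburger
qed

lemma finite_simplices: "finite (simplices K d)"
  using finite_K by (simp add: simplices_def)

lemma finite_alternating: "finite {\<sigma>. alternating K l s d \<sigma> \<and> P \<sigma>}"
  by (rule finite_subset[OF _ finite_K]) (auto dest: alternatingD)

text \<open>
  The antipodal map turns the positive alternating simplices of \<open>- H d\<close> into the negative ones of \<open>H d\<close>.
  No simplex of dimension \<open>d\<close> lies in both hemispheres.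
\<close>

lemma card_positive_alternating:
  assumes "d \<le> n"
  shows "card {\<rho>. alternating K l 1 d \<rho> \<and> (\<rho> \<subseteq> H d \<or> \<rho> \<subseteq> antipode (H d))}
    = card {\<sigma>. (\<exists>s. alternating K l s d \<sigma>) \<and> \<sigma> \<subseteq> H d}"
proof -
  define P where "P = {\<rho>. alternating K l 1 d \<rho> \<and> \<rho> \<subseteq> H d}"
  define Q where "Q = {\<rho>. alternating K l 1 d \<rho> \<and> \<rho> \<subseteq> antipode (H d)}"
  define R where "R = {\<rho>. alternating K l (- 1) d \<rho> \<and> \<rho> \<subseteq> H d}"
  have fin: "finite P" "finite Q" "finite R" unfolding P_def Q_def R_def by (rule finite_alternating)+
  have "P \<inter> Q = {}"
  proof -
    have False if "\<rho> \<in> P" "\<rho> \<in> Q" for \<rho>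
    proof -
      have alt: "alternating K l 1 d \<rho>" and sub: "\<rho> \<subseteq> H d" "\<rho> \<subseteq> antipode (H d)"
        using that by (auto simp: P_def Q_def)
      from subset_both_hemispheres[OF alternatingD(2,3)[OF alt] assms sub]
      have "d \<le> d - 1" "d \<noteq> 0"
        using dim_le_if_subset_H[OF alternatingD(1)[OF alt], of "d - 1"] assms by auto
      then show False by simp
    qed
    then show ?thesis by blast
  qed
  moreover have "P \<inter> R = {}"
  proof -
    have False if "\<rho> \<in> P" "\<rho> \<in> R" for \<rho>
      using that alternating_unique(1)[of 1 d \<rho> "- 1" d] by (simp add: P_def R_def)
    then show ?thesis by blast
  qed
  moreover have "Q = (\<lambda>\<sigma>. antipode \<sigma>) ` R"
  proof (intro set_eqI iffI)
    fix \<rho> assume "\<rho> \<in> Q"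
    then have "antipode \<rho> \<in> R"
      using alternating_antipode[of 1 d \<rho>] antipode_subset_iff'[of \<rho> "H d"] by (simp add: Q_def R_def)
    then show "\<rho> \<in> (\<lambda>\<sigma>. antipode \<sigma>) ` R" by (metis antipode_antipode imageI)
  next
    fix \<rho> assume "\<rho> \<in> (\<lambda>\<sigma>. antipode \<sigma>) ` R"
    then obtain \<sigma> where \<sigma>: "\<sigma> \<in> R" "\<rho> = antipode \<sigma>" by blast
    then show "\<rho> \<in> Q"
      using alternating_antipode[of "- 1" d \<sigma>] by (simp add: Q_def R_def)
  qed
  then have "card Q = card R"
    by (simp add: card_image inj_on_def) (metis antipode_antipode card_image inj_onI)
  ultimately have "card (P \<union> Q) = card (P \<union> R)"
    using fin by (simp add: card_Un_disjoint)
  moreover have "P \<union> Q = {\<rho>. alternating K l 1 d \<rho> \<and> (\<rho> \<subseteq> H d \<or> \<rho> \<subseteq> antipode (H d))}"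
    by (auto simp: P_def Q_def)
  moreover have "P \<union> R = {\<sigma>. (\<exists>s. alternating K l s d \<sigma>) \<and> \<sigma> \<subseteq> H d}"
    using alternatingD(4) by (fastforce simp: P_def R_def)
  ultimately show ?thesis by simp
qed

text \<open>
  Incidences between positive alternating \<open>e\<close>-simplices and \<open>(e + 1)\<close>-simplices of \<open>H (e + 1)\<close> are counted in two ways.
  Modulo 2 only the alternating \<open>(e + 1)\<close>-simplices contribute to one count, and only the
  \<open>e\<close>-simplices on the boundary to the other.
\<close>

lemma odd_alternating_in_hemisphere:
  assumes "d \<le> n"
  shows "odd (card {\<sigma>. (\<exists>s. alternating K l s d \<sigma>) \<and> \<sigma> \<subseteq> H d})"
  using assms
proof (induction d)
  case 0
  obtain x where x: "H 0 = {x}" "x \<noteq> - x" "H 0 \<in> simplices K 0" by (rule H0_simplex)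
  obtain s where "alternating K l s 0 (H 0)" using alternating_vertex[OF x(3)] .
  then have "{\<sigma>. (\<exists>s. alternating K l s 0 \<sigma>) \<and> \<sigma> \<subseteq> H 0} = {H 0}"
    using x(1) alternatingD(3) by (auto simp: subset_singleton_iff)
  then show ?case by simp
next
  case (Suc e)
  define S where "S = {\<tau>\<in>simplices K (Suc e). \<tau> \<subseteq> H (Suc e)}"
  define R where "R = {\<rho>. alternating K l 1 e \<rho> \<and> \<rho> \<subseteq> H (Suc e)}"
  have finS: "finite S" using finite_simplices by (simp add: S_def)
  have finR: "finite R" unfolding R_def by (rule finite_alternating)
  have below: "{\<rho>\<in>R. \<rho> \<subseteq> \<tau>} = {\<rho>. alternating K l 1 e \<rho> \<and> \<rho> \<subseteq> \<tau>}" if "\<tau> \<in> S" for \<tau>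
    using that by (auto simp: R_def S_def)
  have above: "card {\<tau>\<in>S. \<rho> \<subseteq> \<tau>} = (if \<rho> \<subseteq> H e \<or> \<rho> \<subseteq> antipode (H e) then 1 else 2)" if "\<rho> \<in> R" for \<rho>
  proof -
    have "{\<tau>\<in>S. \<rho> \<subseteq> \<tau>} = {\<tau>\<in>simplices K (Suc e). \<rho> \<subseteq> \<tau> \<and> \<tau> \<subseteq> hemisphere H 1 (Suc e)}"
      by (auto simp: S_def hemisphere_def)
    moreover have "\<rho> \<in> simplices K e" "\<rho> \<subseteq> hemisphere H 1 (Suc e)" "e < n"
      using that Suc.prems alternatingD(1)[of 1 e \<rho>] by (auto simp: R_def hemisphere_def)
    ultimately show ?thesis using card_facet_cofaces[of e \<rho> 1] by (simp only:)
  qed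
  have "odd (card {\<rho>\<in>R. \<rho> \<subseteq> \<tau>}) \<longleftrightarrow> (\<exists>s. alternating K l s (Suc e) \<tau>)" if "\<tau> \<in> S" for \<tau>
    using card_facets_alternating[of \<tau> e 1] below[OF that] that by (auto simp: S_def split: if_splits)
  then have "{\<tau>\<in>S. odd (card {\<rho>\<in>R. \<rho> \<subseteq> \<tau>})} = {\<sigma>. (\<exists>s. alternating K l s (Suc e) \<sigma>) \<and> \<sigma> \<subseteq> H (Suc e)}"
    using alternatingD(1) by (auto simp: S_def)
  then have "even (card {\<sigma>. (\<exists>s. alternating K l s (Suc e) \<sigma>) \<and> \<sigma> \<subseteq> H (Suc e)}) \<longleftrightarrow>
      even (\<Sum>\<tau>\<in>S. card {\<rho>\<in>R. \<rho> \<subseteq> \<tau>})"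
    using even_sum_iff[OF finS, of "\<lambda>\<tau>. card {\<rho>\<in>R. \<rho> \<subseteq> \<tau>}"] by simp
  also have "(\<Sum>\<tau>\<in>S. card {\<rho>\<in>R. \<rho> \<subseteq> \<tau>}) = (\<Sum>\<rho>\<in>R. card {\<tau>\<in>S. \<rho> \<subseteq> \<tau>})"
    by (rule sum_multicount_gen[OF finS finR]) simp
  also have "even \<dots> \<longleftrightarrow> even (card {\<rho>\<in>R. odd (card {\<tau>\<in>S. \<rho> \<subseteq> \<tau>})})"
    by (rule even_sum_iff[OF finR])
  also have "{\<rho>\<in>R. odd (card {\<tau>\<in>S. \<rho> \<subseteq> \<tau>})}
      = {\<rho>. alternating K l 1 e \<rho> \<and> (\<rho> \<subseteq> H e \<or> \<rho> \<subseteq> antipode (H e))}"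
    using above subset_next_hemisphere[of e _ 1] Suc.prems
    by (auto simp: R_def hemisphere_def split: if_splits)
  also have "card \<dots> = card {\<sigma>. (\<exists>s. alternating K l s e \<sigma>) \<and> \<sigma> \<subseteq> H e}"
    using card_positive_alternating[of e] Suc.prems by simp
  finally show ?case using Suc by simp
qed

lemma odd_positive_alternating: "odd (card {\<sigma>. alternating K l 1 n \<sigma>})"
proof -
  have "{\<sigma>. alternating K l 1 n \<sigma>}
      = {\<rho>. alternating K l 1 n \<rho> \<and> (\<rho> \<subseteq> H n \<or> \<rho> \<subseteq> antipode (H n))}"
    using subset_top_hemisphere alternatingD(2,3) by blast
  then show ?thesis
    using card_positive_alternating[of n] odd_alternating_in_hemisphere[of n] by simp
qed

lemma card_negative_alternating:
  "card {\<sigma>. alternating K l (- 1) n \<sigma>} = card {\<sigma>. alternating K l 1 n \<sigma>}"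
proof (rule bij_betw_same_card)
  show "bij_betw (\<lambda>\<sigma>. antipode \<sigma>) {\<sigma>. alternating K l (- 1) n \<sigma>} {\<sigma>. alternating K l 1 n \<sigma>}"
    by (rule bij_betw_byWitness[of _ "\<lambda>\<sigma>. antipode \<sigma>"])
      (use alternating_antipode[of 1 n] alternating_antipode[of "- 1" n] in auto)
qed

lemma label_bound: "n + 1 \<le> m"
proof -
  have "{\<sigma>. alternating K l 1 n \<sigma>} \<noteq> {}" using odd_positive_alternating by (metis card.empty even_zero)
  then obtain \<sigma> where \<sigma>: "alternating K l 1 n \<sigma>" by blast
  then obtain k :: "nat \<Rightarrow> int" where k: "1 \<le> k 0" "\<forall>i<n. k i < k (Suc i)"
    "l ` vert \<sigma> = (\<lambda>i. 1 * (- 1) ^ i * k i) ` {..n}"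
    unfolding alternating_def by (elim conjE exE)
  have ge: "int i + 1 \<le> k i" if "i \<le> n" for i
    using that
  proof (induction i)
    case (Suc i)
    then have "k i < k (Suc i)" using k(2) by simp
    then show ?case using Suc by simp
  qed (use k(1) in simp)
  have "1 * (- 1) ^ n * k n \<in> l ` vert \<sigma>" unfolding k(3) by blast
  then obtain v where v: "v \<in> vertices K" "l v = 1 * (- 1) ^ n * k n" by auto
  then have "\<bar>k n\<bar> \<le> int m" using labels by (auto simp: labels_in_def abs_mult power_abs)
  then show ?thesis using ge[of n] by simp
qed

section \<open>The graph of doorways\<close>

definition above :: "'a set \<Rightarrow> 'a set set"
  where "above \<sigma> = {\<tau>. doorway K H l \<sigma> \<tau>}"

definition below :: "'a set \<Rightarrow> 'a set set"
  where "below \<sigma> = {\<rho>. doorway K H l \<rho> \<sigma>}"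

lemma doorway_iff: "doorway K H l \<rho> \<tau> \<longleftrightarrow> (\<exists>s e. alternating K l s e \<rho> \<and> \<tau> \<in> simplices K (Suc e) \<and>
    \<rho> \<subseteq> \<tau> \<and> \<tau> \<subseteq> hemisphere H s (Suc e) \<and> e < n)"
proof -
  have "alternating K l s e \<rho> \<and> \<tau> \<in> simplices K (Suc e) \<and> \<rho> \<subseteq> \<tau> \<and> carried_by H s (Suc e) \<tau> \<longleftrightarrow>
    alternating K l s e \<rho> \<and> \<tau> \<in> simplices K (Suc e) \<and> \<rho> \<subseteq> \<tau> \<and> \<tau> \<subseteq> hemisphere H s (Suc e) \<and> e < n"
    for s e
    using carried_by_iff[of \<tau> "Suc e" s] dim_le[of \<tau> "Suc e"] alternatingD(4)[of s e \<rho>] by auto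
  then show ?thesis unfolding doorway_def by blast
qed

lemma neighbours_eq: "{\<tau>. path_adjacent K H l \<sigma> \<tau>} = above \<sigma> \<union> below \<sigma>"
  by (auto simp: path_adjacent_def above_def below_def)

lemma doorway_card: "doorway K H l \<rho> \<tau> \<Longrightarrow> card (vert \<tau>) = Suc (card (vert \<rho>))"
  by (auto simp: doorway_iff alternating_iff simplices_def)

lemma doorway_in_K: "doorway K H l \<rho> \<tau> \<Longrightarrow> \<rho> \<in> K \<and> \<rho> \<noteq> {} \<and> \<tau> \<in> K \<and> \<tau> \<noteq> {}"
  using alternatingD(2,3) simplex_nonempty unfolding doorway_iff by blast

lemma doorway_antipode: "doorway K H l \<rho> \<tau> \<Longrightarrow> doorway K H l (antipode \<rho>) (antipode \<tau>)"
  unfolding doorway_iff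
proof (elim exE conjE)
  fix s e
  assume *: "alternating K l s e \<rho>" "\<tau> \<in> simplices K (Suc e)" "\<rho> \<subseteq> \<tau>"
    "\<tau> \<subseteq> hemisphere H s (Suc e)" "e < n"
  have "antipode \<tau> \<subseteq> hemisphere H (- s) (Suc e)"
    unfolding hemisphere_uminus[OF alternatingD(4)[OF *(1)]] by (rule image_mono[OF *(4)])
  then show "\<exists>s e. alternating K l s e (antipode \<rho>) \<and> antipode \<tau> \<in> simplices K (Suc e) \<and>
    antipode \<rho> \<subseteq> antipode \<tau> \<and> antipode \<tau> \<subseteq> hemisphere H s (Suc e) \<and> e < n"
    using * alternating_antipode antipode_in_simplices antipode_subset_iff by blast
qed

lemma above_eq:
  assumes "alternating K l s e \<sigma>" "e < n"
  shows "above \<sigma> = {\<tau>\<in>simplices K (Suc e). \<sigma> \<subseteq> \<tau> \<and> \<tau> \<subseteq> hemisphere H s (Suc e)}"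
proof (intro set_eqI iffI)
  fix \<tau> assume "\<tau> \<in> above \<sigma>"
  then obtain t f where *: "alternating K l t f \<sigma>" "\<tau> \<in> simplices K (Suc f)" "\<sigma> \<subseteq> \<tau>"
    "\<tau> \<subseteq> hemisphere H t (Suc f)"
    unfolding above_def doorway_iff mem_Collect_eq by (elim exE conjE)
  have "t = s" "f = e" using alternating_unique[OF *(1) assms(1)] by simp_all
  then show "\<tau> \<in> {\<tau>\<in>simplices K (Suc e). \<sigma> \<subseteq> \<tau> \<and> \<tau> \<subseteq> hemisphere H s (Suc e)}"
    using * by simp
next
  fix \<tau> assume "\<tau> \<in> {\<tau>\<in>simplices K (Suc e). \<sigma> \<subseteq> \<tau> \<and> \<tau> \<subseteq> hemisphere H s (Suc e)}"
  then show "\<tau> \<in> above \<sigma>" using assms unfolding above_def doorway_iff by blast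
qed

lemma card_above:
  assumes "alternating K l s e \<sigma>" "e < n" "\<sigma> \<subseteq> hemisphere H s (Suc e)"
  shows "card (above \<sigma>) = (if \<sigma> \<subseteq> H e \<or> \<sigma> \<subseteq> antipode (H e) then 1 else 2)"
  unfolding above_eq[OF assms(1,2)]
  using card_facet_cofaces[OF assms(2) alternatingD(1)[OF assms(1)] assms(3)] .

text \<open>
  The carrier of \<open>\<sigma>\<close> is unique, so the sign that the doorways into \<open>\<sigma>\<close> must have is determined.
\<close>

lemma below_eq:
  assumes "\<sigma> \<in> simplices K (Suc e)" "s \<in> {1, - 1}" "\<sigma> \<subseteq> hemisphere H s (Suc e)"
  shows "below \<sigma> = {\<rho>. alternating K l s e \<rho> \<and> \<rho> \<subseteq> \<sigma>}"
proof -
  have n: "Suc e \<le> n" using dim_le[OF assms(1)] .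
  have sign: "t = s" if t: "t \<in> {1, - 1}" "\<sigma> \<subseteq> hemisphere H t (Suc e)" for t
  proof (rule ccontr)
    assume "t \<noteq> s"
    then have "\<sigma> \<subseteq> H (Suc e)" "\<sigma> \<subseteq> antipode (H (Suc e))"
      using t assms(2,3) by (auto simp: hemisphere_def)
    from subset_both_hemispheres[OF _ _ n this] show False
      using simplex_nonempty[OF assms(1)] dim_le_if_subset_H[OF assms(1), of e] n by auto
  qed
  show ?thesis
  proof (intro set_eqI iffI)
    fix \<rho> assume "\<rho> \<in> below \<sigma>"
    then obtain t f where *: "alternating K l t f \<rho>" "\<sigma> \<in> simplices K (Suc f)" "\<rho> \<subseteq> \<sigma>"
      "\<sigma> \<subseteq> hemisphere H t (Suc f)"
      unfolding below_def doorway_iff mem_Collect_eq by (elim exE conjE)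
    have "f = e" using simplices_dim_unique[OF *(2) assms(1)] by simp
    then have "t = s" using sign[OF alternatingD(4)[OF *(1)]] *(4) by simp
    then show "\<rho> \<in> {\<rho>. alternating K l s e \<rho> \<and> \<rho> \<subseteq> \<sigma>}" using * \<open>f = e\<close> by simp
  next
    fix \<rho> assume "\<rho> \<in> {\<rho>. alternating K l s e \<rho> \<and> \<rho> \<subseteq> \<sigma>}"
    moreover have "e < n" using n by simp
    ultimately show "\<rho> \<in> below \<sigma>" using assms(1,3) unfolding below_def doorway_iff by blast
  qed
qed

lemma above_empty_unless_alternating: "above \<sigma> \<noteq> {} \<Longrightarrow> \<exists>s e. alternating K l s e \<sigma>"
  by (auto simp: above_def doorway_iff)

lemma below_carrier:
  "below \<sigma> \<noteq> {} \<Longrightarrow> \<exists>s e. \<sigma> \<in> simplices K (Suc e) \<and> s \<in> {1, - 1} \<and> \<sigma> \<subseteq> hemisphere H s (Suc e)"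
  using alternatingD(4) unfolding below_def doorway_iff by blast

lemma finite_neighbours: "finite (above \<sigma>)" "finite (below \<sigma>)"
  using doorway_in_K by (auto simp: above_def below_def intro!: finite_subset[OF _ finite_K])

lemma card_neighbours: "card {\<tau>. path_adjacent K H l \<sigma> \<tau>} = card (above \<sigma>) + card (below \<sigma>)"
proof -
  have False if "\<tau> \<in> above \<sigma>" "\<tau> \<in> below \<sigma>" for \<tau>
    using that doorway_card[of \<sigma> \<tau>] doorway_card[of \<tau> \<sigma>] by (simp add: above_def below_def)
  then have "above \<sigma> \<inter> below \<sigma> = {}" by blast
  then show ?thesis
    unfolding neighbours_eq by (intro card_Un_disjoint finite_neighbours)
qed

lemma H0_start:
  assumes "n \<noteq> 0"
  shows "card {\<tau>. path_adjacent K H l (H 0) \<tau>} = 1"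
proof -
  obtain x where x: "H 0 = {x}" "x \<noteq> - x" "H 0 \<in> simplices K 0" by (rule H0_simplex)
  obtain s where s: "alternating K l s 0 (H 0)" using alternating_vertex[OF x(3)] .
  have "below (H 0) = {}" using below_carrier simplices_dim_unique[OF x(3)] by blast
  moreover have "card (above (H 0)) = 1"
    using card_above[OF s] subset_next_hemisphere[of 0 "H 0" s] assms by simp
  ultimately show ?thesis by (simp add: card_neighbours)
qed

text \<open>
  An alternating \<open>e\<close>-simplex carried by a hemisphere of dimension \<open>e\<close> has one neighbour among its facets and
  one among its cofaces, as it lies on the boundary of the next hemisphere. An alternating \<open>e\<close>-simplex carried
  by a hemisphere of dimension \<open>e + 1\<close> has two cofaces there as neighbours, provided that its sign agrees with
  the hemisphere, and otherwise none. A simplex that is not alternating can only have facets as neighbours.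
\<close>

lemma two_neighbours:
  assumes inner: "\<And>s. \<not> alternating K l s n \<sigma>" "\<sigma> \<noteq> H 0" "\<sigma> \<noteq> antipode (H 0)"
    and ne: "{\<tau>. path_adjacent K H l \<sigma> \<tau>} \<noteq> {}"
  shows "card {\<tau>. path_adjacent K H l \<sigma> \<tau>} = 2"
proof (cases "\<exists>s e. alternating K l s e \<sigma>")
  case True
  then obtain s e where alt: "alternating K l s e \<sigma>" by blast
  have "e \<noteq> n" using alt inner(1) by blast
  then have e: "e < n" using alternatingD(5)[OF alt] by simp
  show ?thesis
  proof (cases "\<sigma> \<subseteq> H e \<or> \<sigma> \<subseteq> antipode (H e)")
    case in_H: True
    have "e \<noteq> 0"
    proof
      assume "e = 0"
      moreover obtain x where "H 0 = {x}" "x \<noteq> - x" "H 0 \<in> simplices K 0" by (rule H0_simplex)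
      ultimately show False using in_H inner(2,3) alternatingD(3)[OF alt] by auto
    qed
    then obtain e' where e': "e = Suc e'" by (cases e) auto
    obtain t :: int where t: "t \<in> {1, - 1}" "\<sigma> \<subseteq> hemisphere H t e"
      using in_H that[of 1] that[of "- 1"] by (auto simp: hemisphere_def)
    have \<sigma>: "\<sigma> \<in> simplices K (Suc e')" using alternatingD(1)[OF alt] e' by simp
    have "card (below \<sigma>) = 1"
      using below_eq[OF \<sigma> t(1)] t(2) e' card_facets_alternating[OF \<sigma> t(1)] alt by (auto split: if_splits)
    moreover have "card (above \<sigma>) = 1"
      using card_above[OF alt e subset_next_hemisphere[OF e in_H]] in_H by simp
    ultimately show ?thesis by (simp add: card_neighbours)
  next
    case False
    have "below \<sigma> = {}"
    proof (rule ccontr)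
      assume "below \<sigma> \<noteq> {}"
      then obtain t e' where "\<sigma> \<in> simplices K (Suc e')" "t \<in> {1, - 1}" "\<sigma> \<subseteq> hemisphere H t (Suc e')"
        using below_carrier by blast
      moreover from this have "Suc e' = e" using simplices_dim_unique[OF _ alternatingD(1)[OF alt]] by blast
      ultimately show False using False by (auto simp: hemisphere_def split: if_splits)
    qed
    then have "above \<sigma> \<noteq> {}" using ne neighbours_eq by blast
    then have "\<sigma> \<subseteq> hemisphere H s (Suc e)" using above_eq[OF alt e] by auto
    then show ?thesis
      using card_above[OF alt e] False \<open>below \<sigma> = {}\<close> by (simp add: card_neighbours)
  qed
next
  case False
  then have "above \<sigma> = {}" using above_empty_unless_alternating by blast
  then have "below \<sigma> \<noteq> {}" using ne neighbours_eq by blast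
  then obtain t e where \<sigma>: "\<sigma> \<in> simplices K (Suc e)" and t: "t \<in> {1, - 1}" "\<sigma> \<subseteq> hemisphere H t (Suc e)"
    using below_carrier by blast
  have "card (below \<sigma>) = 0 \<or> card (below \<sigma>) = 2"
    using below_eq[OF \<sigma> t] card_facets_alternating[OF \<sigma> t(1)] False by (auto split: if_splits)
  then show ?thesis
    using \<open>below \<sigma> \<noteq> {}\<close> \<open>above \<sigma> = {}\<close> finite_neighbours(2)[of \<sigma>] by (simp add: card_neighbours)
qed

lemma path_following_run_exists: "\<exists>ps. path_following_run K H l n ps"
proof -
  let ?N = "\<lambda>\<sigma>. {\<tau>. path_adjacent K H l \<sigma> \<tau>}"
  let ?Goal = "{\<sigma>. \<exists>s. alternating K l s n \<sigma>}"
  obtain x where x: "H 0 = {x}" "x \<noteq> - x" "H 0 \<in> simplices K 0" by (rule H0_simplex)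
  obtain s where s: "alternating K l s 0 (H 0)" using alternating_vertex[OF x(3)] .
  obtain ps where ps: "ps \<noteq> []" "ps ! 0 = H 0"
    "\<forall>i. Suc i < length ps \<longrightarrow> ps ! i \<notin> ?Goal \<and> ?N (ps ! i) - set (take i ps) = {ps ! Suc i}"
    "last ps \<in> ?Goal"
  proof (rule path_to_goal[where N = ?N and S = K and \<iota> = "\<lambda>\<sigma>. antipode \<sigma>" and a = "H 0"
        and dim = "\<lambda>\<sigma>. card (vert \<sigma>)" and Goal = ?Goal])
    show "\<sigma> \<in> ?N \<tau>" if "\<tau> \<in> ?N \<sigma>" for \<sigma> \<tau> using that by (auto simp: path_adjacent_def)
    show "finite K" by (rule finite_K)
    show "?N \<sigma> \<subseteq> K" for \<sigma> using doorway_in_K by (auto simp: path_adjacent_def)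
    show "even (card (vert \<tau>)) \<longleftrightarrow> odd (card (vert \<sigma>))" if "\<tau> \<in> ?N \<sigma>" for \<sigma> \<tau>
      using that doorway_card[of \<sigma> \<tau>] doorway_card[of \<tau> \<sigma>] by (auto simp: path_adjacent_def)
    show "antipode \<tau> \<in> ?N (antipode \<sigma>)" if "\<tau> \<in> ?N \<sigma>" for \<sigma> \<tau>
      using that doorway_antipode by (auto simp: path_adjacent_def)
    show "antipode (antipode \<sigma>) = \<sigma>" for \<sigma> :: "'a set" by simp
    show "antipode \<sigma> \<noteq> \<sigma>" if "?N \<sigma> \<noteq> {}" for \<sigma>
      using that doorway_in_K antipode_neq by (auto simp: path_adjacent_def)
    show "antipode (H 0) \<noteq> H 0" using x(1,2) by auto
    show "card (vert (antipode (H 0))) = card (vert (H 0))"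
      by (simp add: vert_antipode card_antipode)
    show "card (?N (H 0)) = 1" if "H 0 \<notin> ?Goal"
      using that s H0_start by (cases "n = 0") auto
    show "card (?N \<sigma>) = 2" if "\<sigma> \<notin> ?Goal" "\<sigma> \<noteq> H 0" "\<sigma> \<noteq> antipode (H 0)" "?N \<sigma> \<noteq> {}" for \<sigma>
      using that by (intro two_neighbours) auto
  qed
  have "path_following_run K H l n ps"
    unfolding path_following_run_def using ps by blast
  then show ?thesis by blast
qed

end

theorem theorem1:
  fixes n m :: nat
    and C :: "'b::euclidean_space set set"
    and h :: "'b \<Rightarrow> 'a::euclidean_space"
    and K :: "'a set set"
    and H :: "nat \<Rightarrow> 'a set"
    and l :: "'a \<Rightarrow> int"
  assumes "DIM('a) = n + 1"
    and "triangulates C h (sphere 0 1) K"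
    and "symmetric_triangulation K"
    and "aligned_with K n H"
    and "labels_in K l m"
    and "antisymmetric_labelling K l"
    and "\<not> (\<exists>\<sigma>. complementary_edge K l \<sigma>)"
  shows "odd (card {\<sigma>. alternating K l 1 n \<sigma>})
    \<and> card {\<sigma>. alternating K l (- 1) n \<sigma>} = card {\<sigma>. alternating K l 1 n \<sigma>}
    \<and> m \<ge> n + 1
    \<and> (\<exists>ps s. path_following_run K H l n ps
          \<and> alternating K l s n (last ps)
          \<and> alternating K l (- s) n (antipode (last ps)))"
proof -
  interpret labelled_triangulation n C h K H l m
    using assms by unfold_locales
  obtain ps where run: "path_following_run K H l n ps" using path_following_run_exists by blast
  then obtain s where "alternating K l s n (last ps)" by (auto simp: path_following_run_def)
  then show ?thesis
    using run odd_positive_alternating card_negative_alternating label_bound alternating_antipode by blast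
qed

end
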